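(* For every real number $c>2$ and every positive integer $\mu$, there exists a weakly chordal graph $G$ such that no set of at most $\mu$ spanning trees of $G$ collectively $+c$-spans $G$; likewise, for every real number $c>2$ and every positive integer $\mu$, there exists an outerplanar graph $G$ such that no set of at most $\mu$ spanning trees of $G$ collectively $+c$-spans $G$.
   Context: All graphs are connected, finite, undirected, loopless and without multiple edges; $\mathrm{dist}_G(u,v)$ is the number of edges of a shortest path between $u$ and $v$ in $G$. For $c\ge 0$, a set $\mathcal{T}$ of spanning trees of a graph $G$ collectively $+c$-spans $G$ if for any two vertices $u,v$ of $G$ there is a tree $T\in\mathcal{T}$ with $\mathrm{dist}_T(u,v)\le \mathrm{dist}_G(u,v)+c$. A graph $G$ is weakly chordal if neither $G$ nor its complement contains an induced cycle of length at least 5. A graph is outerplanar if it can be drawn in the plane without crossings such that all vertices belong to the unbounded face of the drawing. *)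

theory Defs
  imports "HOL-Analysis.Analysis" "Graph_Theory.Graph_Theory"
begin

text \<open>
  Finite simple undirected graphs are symmetric, loopless digraphs whose arcs are pairs of
  vertices (locale \<open>pair_graph\<close>); an edge \<open>uv\<close> is the pair of arcs \<open>(u, v)\<close> and \<open>(v, u)\<close>.
  The name \<open>connected\<close> is qualified because HOL-Analysis has a topological notion of that name.
\<close>

definition connected_graph :: "'a pair_pre_digraph \<Rightarrow> bool" where
  "connected_graph G \<longleftrightarrow> pair_graph G \<and> Digraph_Component.connected (with_proj G)"

text \<open>Only meaningful if \<open>v\<close> is reachable from \<open>u\<close>; used for connected graphs only.\<close>

definition graph_dist :: "'a pair_pre_digraph \<Rightarrow> 'a \<Rightarrow> 'a \<Rightarrow> nat" where
  "graph_dist G u v = (LEAST n. \<exists>p. pre_digraph.apath (with_proj G) u p v \<and> length p = n)"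

text \<open>
  The library predicates \<open>tree\<close> and \<open>spanning_tree\<close> forbid every directed cycle. In a symmetric
  digraph each edge yields the directed cycle \<open>u, v, u\<close>, so they cannot be used for undirected
  graphs; the cycles of an undirected simple graph are the directed cycles of length at least 3.
\<close>

definition undirected_tree :: "'a pair_pre_digraph \<Rightarrow> bool" where
  "undirected_tree T \<longleftrightarrow>
     connected_graph T \<and> \<not> (\<exists>p. pre_digraph.cycle (with_proj T) p \<and> 3 \<le> length p)"

definition undirected_spanning_tree :: "'a pair_pre_digraph \<Rightarrow> 'a pair_pre_digraph \<Rightarrow> bool" where
  "undirected_spanning_tree T G \<longleftrightarrow>
     undirected_tree T \<and> spanning (with_proj T) (with_proj G)"

definition collectively_spans ::
    "real \<Rightarrow> 'a pair_pre_digraph set \<Rightarrow> 'a pair_pre_digraph \<Rightarrow> bool" where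
  "collectively_spans c \<T> G \<longleftrightarrow>
     (\<forall>T\<in>\<T>. undirected_spanning_tree T G) \<and>
     (\<forall>u\<in>pverts G. \<forall>v\<in>pverts G. \<exists>T\<in>\<T>. real (graph_dist T u v) \<le> real (graph_dist G u v) + c)"

definition graph_complement :: "'a pair_pre_digraph \<Rightarrow> 'a pair_pre_digraph" where
  "graph_complement G =
     \<lparr> pverts = pverts G,
       parcs = {(u, v). u \<in> pverts G \<and> v \<in> pverts G \<and> u \<noteq> v \<and> (u, v) \<notin> parcs G} \<rparr>"

text \<open>
  \<open>vs\<close> lists, in cyclic order, the vertices of an induced cycle of length \<open>length vs\<close>.
\<close>

definition induced_cycle :: "'a pair_pre_digraph \<Rightarrow> 'a list \<Rightarrow> bool" where
  "induced_cycle G vs \<longleftrightarrow>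
     3 \<le> length vs \<and> distinct vs \<and> set vs \<subseteq> pverts G \<and>
     (\<forall>i<length vs. \<forall>j<length vs.
        (vs ! i, vs ! j) \<in> parcs G \<longleftrightarrow>
        j = Suc i mod length vs \<or> i = Suc j mod length vs)"

definition weakly_chordal :: "'a pair_pre_digraph \<Rightarrow> bool" where
  "weakly_chordal G \<longleftrightarrow>
     \<not> (\<exists>vs. 5 \<le> length vs \<and> induced_cycle G vs) \<and>
     \<not> (\<exists>vs. 5 \<le> length vs \<and> induced_cycle (graph_complement G) vs)"

definition graph_edges :: "'a pair_pre_digraph \<Rightarrow> 'a set set" where
  "graph_edges G = {{u, v} | u v. (u, v) \<in> parcs G}"

text \<open>
  A drawing places the vertices at distinct points \<open>f v\<close> of the plane and represents each edge
  \<open>e\<close> by one simple arc \<open>\<gamma> e\<close> (traversed in either direction) joining its end vertices. Arcs avoid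
  all other vertices, and two arcs meet at most in their common end vertices.
\<close>

definition plane_drawing ::
    "'a pair_pre_digraph \<Rightarrow> ('a \<Rightarrow> complex) \<Rightarrow> ('a set \<Rightarrow> real \<Rightarrow> complex) \<Rightarrow> bool" where
  "plane_drawing G f \<gamma> \<longleftrightarrow>
     inj_on f (pverts G) \<and>
     (\<forall>e\<in>graph_edges G.
        arc (\<gamma> e) \<and>
        {pathstart (\<gamma> e), pathfinish (\<gamma> e)} = f ` e \<and>
        path_image (\<gamma> e) \<inter> f ` pverts G = f ` e) \<and>
     (\<forall>e\<in>graph_edges G. \<forall>e'\<in>graph_edges G.
        e \<noteq> e' \<longrightarrow> path_image (\<gamma> e) \<inter> path_image (\<gamma> e') = f ` (e \<inter> e'))"

definition drawing_image ::
    "'a pair_pre_digraph \<Rightarrow> ('a \<Rightarrow> complex) \<Rightarrow> ('a set \<Rightarrow> real \<Rightarrow> complex) \<Rightarrow> complex set" where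
  "drawing_image G f \<gamma> = f ` pverts G \<union> (\<Union>e\<in>graph_edges G. path_image (\<gamma> e))"

text \<open>
  The drawing of a finite graph is compact, so \<open>outside\<close> of it is its unique unbounded face.
  A vertex belongs to a face if it lies on the boundary of that face.
\<close>

definition outerplanar :: "'a pair_pre_digraph \<Rightarrow> bool" where
  "outerplanar G \<longleftrightarrow>
     (\<exists>f \<gamma>. plane_drawing G f \<gamma> \<and> f ` pverts G \<subseteq> frontier (outside (drawing_image G f \<gamma>)))"

end

theory Submission
  imports Defs
begin

text \<open>
  One graph serves both parts: a tree-like arrangement of blocks, each a triangle continued by a
  ladder of length \<open>k\<close>, where copies of smaller arrangements hang at all vertices of a block.
  A spanning tree that uses no rung of a block puts the ends of the last rung \<open>2 k\<close> apart. A spanning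
  tree that uses a rung reaches one of its ends, seen from the apex of the block, with an additive
  stretch of at least 1, and these stretches add up along a descent through nested blocks. So
  one descends, collecting stretch for the trees that keep using rungs, until a tree uses none
  in a deep enough part below; there the number of trees that use rungs has dropped, and one
  starts again from the last rung of a block, which is bad for all trees without rungs. In the
  end a single pair of vertices is bad for all trees.

  The blocks have no induced cycles of length at least 5, nor antiholes, and putting the vertices
  in preorder on a parabola gives an outerplanar straight-line drawing.
\<close>

section \<open>Distances in connected graphs and trees\<close>

lemma connected_graph_reachable:
  assumes "connected_graph T" "u \<in> pverts T" "v \<in> pverts T"
  shows "\<exists>p. pre_digraph.awalk (with_proj T) u p v"
proof -
  interpret pair_graph T using assms(1) by (simp add: connected_graph_def)
  have "strongly_connected (with_proj T)"
    using assms(1) symmetric_connected_imp_strongly_connected pair_sym_arcs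
    by (auto simp: connected_graph_def)
  then show ?thesis using assms by (auto simp: reachable_awalk[symmetric])
qed

text \<open>\<open>graph_dist\<close> minimises over paths; turning a walk into a path only cuts out
  closed pieces, so arbitrary walks give upper bounds as well.\<close>

lemma graph_dist_le_length:
  assumes "pair_wf_digraph T" "pre_digraph.awalk (with_proj T) u p v"
  shows "graph_dist T u v \<le> length p"
proof -
  interpret pair_wf_digraph T by fact
  have "awalk u q v \<Longrightarrow> length (awalk_to_apath q) \<le> length q" for q
  proof (induct rule: awalk_to_apath_induct)
    case (path q)
    then show ?case by (auto simp: awalk_to_apath.simps)
  next
    case (decomp q a b c)
    then have "q = a @ b @ c" by (auto elim: awalk_cyc_decompE)
    then show ?case using decomp step_awalk_to_apath[of _ q _ a b c] by simp
  qed
  then have "length (awalk_to_apath p) \<le> length p" using assms by blast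
  moreover have "graph_dist T u v \<le> length (awalk_to_apath p)"
    unfolding graph_dist_def using apath_awalk_to_apath[OF assms(2)] by (intro Least_le) blast
  ultimately show ?thesis by simp
qed

lemma graph_dist_walk:
  assumes "connected_graph T" "u \<in> pverts T" "v \<in> pverts T"
  obtains p where "pre_digraph.awalk (with_proj T) u p v" "length p = graph_dist T u v"
proof -
  interpret pair_graph T using assms(1) by (simp add: connected_graph_def)
  have "\<exists>n p. apath u p v \<and> length p = n"
    using connected_graph_reachable[OF assms] apath_awalk_to_apath by blast
  then have "\<exists>p. apath u p v \<and> length p = graph_dist T u v"
    unfolding graph_dist_def by (rule LeastI_ex)
  then show ?thesis using that by (auto simp: apath_def)
qed

lemma graph_dist_self:
  assumes "pair_wf_digraph T" "u \<in> pverts T"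
  shows "graph_dist T u u = 0"
proof -
  interpret pair_wf_digraph T by fact
  show ?thesis using graph_dist_le_length[OF assms(1), of u "[]" u] assms(2) by (simp add: awalk_Nil_iff)
qed

lemma graph_dist_triangle:
  assumes "connected_graph T" "u \<in> pverts T" "v \<in> pverts T" "w \<in> pverts T"
  shows "graph_dist T u w \<le> graph_dist T u v + graph_dist T v w"
proof -
  interpret pair_graph T using assms(1) by (simp add: connected_graph_def)
  obtain p where p: "awalk u p v" "length p = graph_dist T u v"
    by (rule graph_dist_walk[OF assms(1-3)])
  obtain q where q: "awalk v q w" "length q = graph_dist T v w"
    by (rule graph_dist_walk[OF assms(1,3,4)])
  show ?thesis using graph_dist_le_length[OF pair_wf_digraph awalk_appendI[OF p(1) q(1)]] p q by simp
qed

lemma graph_dist_arc: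
  assumes "pair_wf_digraph T" "(u, v) \<in> parcs T"
  shows "graph_dist T u v \<le> 1"
proof -
  interpret pair_wf_digraph T by fact
  show ?thesis using graph_dist_le_length[OF assms(1), of u "[(u, v)]" v] assms(2)
    by (simp add: awalk_simps in_arcsD2)
qed

lemma graph_dist_arc_right:
  assumes "connected_graph T" "u \<in> pverts T" "(v, w) \<in> parcs T"
  shows "graph_dist T u w \<le> graph_dist T u v + 1"
proof -
  interpret pair_graph T using assms(1) by (simp add: connected_graph_def)
  show ?thesis
    using graph_dist_triangle[OF assms(1,2) in_arcsD1 in_arcsD2, OF assms(3,3)]
      graph_dist_arc[OF _ assms(3)] pair_wf_digraph by fastforce
qed

lemma graph_dist_arc_left:
  assumes "connected_graph T" "w \<in> pverts T" "(u, v) \<in> parcs T"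
  shows "graph_dist T u w \<le> graph_dist T v w + 1"
proof -
  interpret pair_graph T using assms(1) by (simp add: connected_graph_def)
  show ?thesis
    using graph_dist_triangle[OF assms(1) in_arcsD1 in_arcsD2, OF assms(3,3,2)]
      graph_dist_arc[OF _ assms(3)] pair_wf_digraph by fastforce
qed

text \<open>Telescoping along a shortest walk. The lower bounds on distances for tree edges, blocks
  and cut vertices all come from such potentials; integer values leave room for signed ones.\<close>

lemma graph_dist_lipschitz:
  fixes \<phi> :: "'a \<Rightarrow> int"
  assumes "connected_graph T" "u \<in> pverts T" "v \<in> pverts T"
    and lip: "\<And>x y. (x, y) \<in> parcs T \<Longrightarrow> \<phi> y \<le> \<phi> x + 1"
  shows "\<phi> v - \<phi> u \<le> int (graph_dist T u v)"
proof -
  interpret pair_graph T using assms(1) by (simp add: connected_graph_def)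
  have "\<phi> v - \<phi> a \<le> int (length p)" if "awalk a p v" for a p
    using that
  proof (induction p arbitrary: a)
    case (Cons e p)
    then show ?case using lip[of "fst e" "snd e"] by (force simp: awalk_simps)
  qed (simp add: awalk_simps)
  then show ?thesis using graph_dist_walk assms(1-3) by metis
qed

lemma graph_dist_subgraph:
  assumes "connected_graph T" "connected_graph G" "pverts T = pverts G" "parcs T \<subseteq> parcs G"
    and "u \<in> pverts G" "v \<in> pverts G"
  shows "graph_dist G u v \<le> graph_dist T u v"
proof -
  interpret G: pair_graph G using assms(2) by (simp add: connected_graph_def)
  interpret T: pair_graph T using assms(1) by (simp add: connected_graph_def)
  obtain p where p: "T.awalk u p v" "length p = graph_dist T u v"
    using graph_dist_walk assms by metis
  then have "G.awalk u p v" using assms(3-) by (auto simp: G.awalk_def T.awalk_def)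
  then show ?thesis using graph_dist_le_length G.pair_wf_digraph p by metis
qed

text \<open>A second route from \<open>u\<close> to \<open>w\<close>, shortened to a path, would
  close up with the arc \<open>(w, u)\<close> to a cycle of length at least 3.\<close>

lemma undirected_tree_bridge:
  assumes T: "undirected_tree T" and uw: "(u, w) \<in> parcs T"
  shows "(u, w) \<notin> (parcs T - {(u, w), (w, u)})\<^sup>*"
proof
  interpret pair_graph T using T by (simp add: undirected_tree_def connected_graph_def)
  define R where "R = parcs T - {(u, w), (w, u)}"
  assume "(u, w) \<in> (parcs T - {(u, w), (w, u)})\<^sup>*"
  then have "(u, w) \<in> R\<^sup>*" by (simp add: R_def)
  have "\<exists>p. awalk u p x \<and> set p \<subseteq> R" if "(u, x) \<in> R\<^sup>*" for x
    using that
  proof induction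
    case base
    show ?case using uw by (intro exI[of _ "[]"]) (auto simp: awalk_Nil_iff in_arcsD1)
  next
    case (step y z)
    from step.IH obtain p where "awalk u p y" "set p \<subseteq> R" by blast
    with step.hyps(2) show ?case
      by (intro exI[of _ "p @ [(y, z)]"]) (auto simp: awalk_simps in_arcsD2 R_def)
  qed
  then obtain p where p: "awalk u p w" "set p \<subseteq> R" using \<open>(u, w) \<in> R\<^sup>*\<close> by blast
  define q where "q = awalk_to_apath p"
  have q: "apath u q w" "set q \<subseteq> R"
    using p apath_awalk_to_apath awalk_to_apath_subset unfolding q_def by blast+
  have ne: "u \<noteq> w" using uw no_loops' by blast
  \<comment> \<open>A path of length 1 would be the arc \<open>(u, w)\<close>, which
    \<open>R\<close> omits, and \<open>u \<noteq> w\<close> excludes length 0.\<close>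
  have "2 \<le> length q"
  proof (rule ccontr)
    assume "\<not> 2 \<le> length q"
    then consider "q = []" | e where "q = [e]" by (cases q; cases "tl q") auto
    then show False using q ne by cases (auto simp: apath_def awalk_simps R_def)
  qed
  moreover have "(w, u) \<in> parcs T" using uw arcs_symmetric by blast
  then have "cycle ((w, u) # q)"
    using q unfolding cycle_def by (intro exI[of _ w]) (auto simp: apath_def awalk_simps)
  ultimately have "\<exists>p. cycle p \<and> 3 \<le> length p" by (intro exI[of _ "(w, u) # q"]) simp
  then show False using T by (simp add: undirected_tree_def)
qed

text \<open>The tree edge \<open>uw\<close> is a bridge, so the distance to \<open>a\<close> must change across it.\<close>

lemma undirected_tree_dist_neq:
  assumes T: "undirected_tree T" and uw: "(u, w) \<in> parcs T" and a: "a \<in> pverts T"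
  shows "graph_dist T a u \<noteq> graph_dist T a w"
proof -
  have conn: "connected_graph T" using T by (simp add: undirected_tree_def)
  interpret pair_graph T using conn by (simp add: connected_graph_def)
  let ?R = "parcs T - {(u, w), (w, u)}"
  have "sym ?R" using arcs_symmetric by (auto simp: sym_def)
  define U where "U = {x. (u, x) \<in> ?R\<^sup>*}"
  have U: "u \<in> U" "w \<notin> U" using undirected_tree_bridge[OF T uw] by (auto simp: U_def)
  have cross: "x = u \<and> y = w \<or> x = w \<and> y = u" if "(x, y) \<in> parcs T" "(x \<in> U) \<noteq> (y \<in> U)" for x y
  proof (rule ccontr)
    assume "\<not> ?thesis"
    then have "(x, y) \<in> ?R" using that(1) by auto
    moreover from this have "(y, x) \<in> ?R" using \<open>sym ?R\<close> by (meson symD)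
    ultimately show False using that(2) unfolding U_def by (auto intro: rtrancl_into_rtrancl)
  qed
  have lip: "int (graph_dist T a y) \<le> int (graph_dist T a x) + 1" if "(x, y) \<in> parcs T" for x y
    using graph_dist_arc_right[OF conn a that] by linarith
  have 0: "graph_dist T a a = 0" by (rule graph_dist_self[OF pair_wf_digraph a])
  have uwv: "u \<in> pverts T" "w \<in> pverts T" using uw in_arcsD1 in_arcsD2 by auto
  show ?thesis
  proof (cases "a \<in> U")
    case True
    \<comment> \<open>Beyond the bridge the potential is frozen at one more than its value at
      \<open>u\<close>. Only the bridge leaves \<open>U\<close>, so the growth per arc is still at
      most 1, which yields \<open>graph_dist T a u + 1 \<le> graph_dist T a w\<close>.\<close>
    define \<phi> where "\<phi> x = int (if x \<in> U then graph_dist T a x else graph_dist T a u + 1)" for x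
    have "\<phi> w - \<phi> a \<le> int (graph_dist T a w)"
    proof (rule graph_dist_lipschitz[OF conn a uwv(2)])
      fix x y assume xy: "(x, y) \<in> parcs T"
      show "\<phi> y \<le> \<phi> x + 1"
        using lip[OF xy] cross[OF xy] U by (auto simp: \<phi>_def)
    qed
    then show ?thesis using True U 0 by (auto simp: \<phi>_def)
  next
    case False
    define \<phi> where "\<phi> x = int (if x \<notin> U then graph_dist T a x else graph_dist T a w + 1)" for x
    have "\<phi> u - \<phi> a \<le> int (graph_dist T a u)"
    proof (rule graph_dist_lipschitz[OF conn a uwv(1)])
      fix x y assume xy: "(x, y) \<in> parcs T"
      show "\<phi> y \<le> \<phi> x + 1"
        using lip[OF xy] cross[OF xy] U by (auto simp: \<phi>_def)
    qed
    then show ?thesis using False U 0 by (auto simp: \<phi>_def)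
  qed
qed

section \<open>A pair of vertices that is bad for all trees\<close>

text \<open>
  Vertices are numbers below \<open>m ^ D\<close>. For \<open>m ^ d dvd a\<close>, the numbers that agree with \<open>a\<close>
  up to the last \<open>d\<close> digits form a subgraph attached to the rest of the graph at \<open>a\<close> only, and the
  vertices \<open>a + j * m ^ d\<close> form a single ladder block. The three conjuncts are all that the
  lower bound uses about the additive stretch \<open>\<epsilon>\<close> of a tree: cut vertices make it superadditive,
  and each block either separates its last rung \<open>{k, Suc k}\<close> or costs one unit to cross.
\<close>

definition excess_system :: "nat \<Rightarrow> nat \<Rightarrow> nat \<Rightarrow> nat \<Rightarrow> (nat \<Rightarrow> nat \<Rightarrow> int) \<Rightarrow> bool" where
  "excess_system m k C D \<epsilon> \<longleftrightarrow>
     (\<forall>z<m ^ D. \<forall>x<m ^ D. 0 \<le> \<epsilon> z x) \<and>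
     (\<forall>d a z x. m ^ d dvd a \<and> a < m ^ D \<and> z < m ^ D \<and> x < m ^ D \<and>
        x div m ^ d = a div m ^ d \<and> z div m ^ d \<noteq> a div m ^ d \<longrightarrow> \<epsilon> z a + \<epsilon> a x \<le> \<epsilon> z x) \<and>
     (\<forall>d<D. \<forall>a<m ^ D. m ^ Suc d dvd a \<longrightarrow>
        int C < \<epsilon> (a + k * m ^ d) (a + Suc k * m ^ d) \<or> (\<exists>j<m. 1 \<le> \<epsilon> a (a + j * m ^ d)))"

text \<open>A witness is a block below \<open>a\<close> whose last rung is not separated; by the
  block condition of \<open>excess_system\<close> such a block offers a unit of excess. The level
  bound \<open>e0\<close> allows restriction to a window of levels, in which fewer trees may be
  twisted.\<close>

definition twisted :: "nat \<Rightarrow> nat \<Rightarrow> nat \<Rightarrow> nat \<Rightarrow> nat \<Rightarrow> nat \<Rightarrow> (nat \<Rightarrow> nat \<Rightarrow> int) \<Rightarrow> bool" where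
  "twisted m k C e0 a d \<epsilon> \<longleftrightarrow>
     (\<exists>e b. e0 \<le> e \<and> e < d \<and> m ^ Suc e dvd b \<and> b div m ^ d = a div m ^ d \<and>
        \<epsilon> (b + k * m ^ e) (b + Suc k * m ^ e) \<le> int C)"

lemma div_power_eq_mono:
  fixes m x y :: nat
  assumes "x div m ^ d = y div m ^ d" "d \<le> e"
  shows "x div m ^ e = y div m ^ e"
  using assms by (metis div_mult2_eq le_add_diff_inverse power_add)

lemma less_power_if_div_eq:
  fixes m x a :: nat
  assumes "x div m ^ d = a div m ^ d" "a < m ^ D" "d \<le> D"
  shows "x < m ^ D"
proof -
  have "0 < m ^ D" using assms(2) by (rule le_less_trans[rotated]) simp
  moreover have "x div m ^ D = 0" using div_power_eq_mono[OF assms(1,3)] assms(2) by simp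
  ultimately show ?thesis by (metis div_greater_zero_iff leI less_irrefl)
qed

lemma div_add_digit:
  fixes m a j :: nat
  assumes "m ^ Suc d dvd a" "j < m"
  shows "(a + j * m ^ d) div m ^ Suc d = a div m ^ Suc d"
proof -
  have "0 < m" using assms(2) by simp
  then have "j * m ^ d < m ^ Suc d" using assms(2) by simp
  then show ?thesis using assms(1) by (auto simp: dvd_def)
qed

lemma twisted_mono:
  assumes "twisted m k C e0 a d \<epsilon>" "e1 \<le> e0" "d \<le> d'" "a div m ^ d' = a' div m ^ d'"
  shows "twisted m k C e1 a' d' \<epsilon>"
proof -
  obtain e b where eb: "e0 \<le> e" "e < d" "m ^ Suc e dvd b" "b div m ^ d = a div m ^ d"
    "\<epsilon> (b + k * m ^ e) (b + Suc k * m ^ e) \<le> int C" using assms(1) by (auto simp: twisted_def)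
  have "b div m ^ d' = a' div m ^ d'"
    using div_power_eq_mono[OF eb(4) assms(3)] assms(4) by simp
  then show ?thesis unfolding twisted_def using eb assms(2,3)
    by (intro exI[of _ e] exI[of _ b] conjI) simp_all
qed

text \<open>
  Induction on the number of trees that are twisted somewhere below \<open>a\<close>. Descend from a
  fixed \<open>z\<close>: as long as some tree with small excess is still twisted, move to a twisted block
  of it and gain one unit of excess; once it is not, the number of twisted trees has dropped.
\<close>

lemma common_excess_pair_aux:
  assumes m: "Suc k < m"
  shows "\<exists>N. \<forall>D E a d e0. finite E \<longrightarrow> (\<forall>\<epsilon>\<in>E. excess_system m k C D \<epsilon>) \<longrightarrow>
    m ^ d dvd a \<longrightarrow> a < m ^ D \<longrightarrow> e0 + N \<le> d \<longrightarrow> d \<le> D \<longrightarrow>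
    card {\<epsilon> \<in> E. twisted m k C e0 a d \<epsilon>} < n \<longrightarrow>
    (\<exists>z<m ^ D. \<exists>x<m ^ D. \<forall>\<epsilon>\<in>E. int C < \<epsilon> z x)"
proof (induction n)
  case (Suc n)
  obtain N where N: "\<And>D E a d e0. \<lbrakk>finite E; \<forall>\<epsilon>\<in>E. excess_system m k C D \<epsilon>; m ^ d dvd a; a < m ^ D;
      e0 + N \<le> d; d \<le> D; card {\<epsilon> \<in> E. twisted m k C e0 a d \<epsilon>} < n\<rbrakk> \<Longrightarrow>
      \<exists>z<m ^ D. \<exists>x<m ^ D. \<forall>\<epsilon>\<in>E. int C < \<epsilon> z x"
    by (rule exE[OF Suc.IH]) (rule that, elim allE impE, assumption+)
  \<comment> \<open>One level is spent on the starting rung, then \<open>N\<close> levels for each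
    unit of a total deficit of at most \<open>n * Suc C\<close>.\<close>
  have "\<exists>z<m ^ D. \<exists>x<m ^ D. \<forall>\<epsilon>\<in>E. int C < \<epsilon> z x"
    if E: "finite E" "\<forall>\<epsilon>\<in>E. excess_system m k C D \<epsilon>" and a0: "m ^ d0 dvd a0" "a0 < m ^ D"
      and d0: "e0 + Suc (n * Suc C * N) \<le> d0" "d0 \<le> D"
      and card: "card {\<epsilon> \<in> E. twisted m k C e0 a0 d0 \<epsilon>} < Suc n" for D E a0 d0 e0
  proof -
    define J where "J = {\<epsilon> \<in> E. twisted m k C e0 a0 d0 \<epsilon>}"
    have J: "J \<subseteq> E" "finite J" "card J < Suc n" using E card by (auto simp: J_def)
    have nonneg: "0 \<le> \<epsilon> z x" if "\<epsilon> \<in> E" "z < m ^ D" "x < m ^ D" for \<epsilon> z x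
      using E that by (auto simp: excess_system_def)
    have super: "\<epsilon> z a + \<epsilon> a x \<le> \<epsilon> z x"
      if "\<epsilon> \<in> E" "m ^ d dvd a" "a < m ^ D" "z < m ^ D" "x < m ^ D"
        "x div m ^ d = a div m ^ d" "z div m ^ d \<noteq> a div m ^ d" for \<epsilon> d a z x
      using E(2) that unfolding excess_system_def by blast
    have block: "int C < \<epsilon> (a + k * m ^ d) (a + Suc k * m ^ d) \<or> (\<exists>j<m. 1 \<le> \<epsilon> a (a + j * m ^ d))"
      if "\<epsilon> \<in> E" "d < D" "a < m ^ D" "m ^ Suc d dvd a" for \<epsilon> d a
      using E(2) that unfolding excess_system_def by blast
    \<comment> \<open>\<open>q\<close> bounds the total amount by which the trees of
      \<open>J\<close> fall short of \<open>Suc C\<close>. Each step lowers it by at least 1 and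
      consumes at most \<open>N\<close> levels. Trees outside \<open>J\<close> already exceed
      \<open>C\<close> and are not twisted below \<open>a\<close>, so they never enter the count
      again.\<close>
    have descend: "\<exists>z<m ^ D. \<exists>x<m ^ D. \<forall>\<epsilon>\<in>E. int C < \<epsilon> z x"
      if "m ^ d dvd a" "a < m ^ D" "d \<le> D" "z < m ^ D" "z div m ^ d \<noteq> a div m ^ d"
        "e0 + q * N \<le> d" "(\<Sum>\<epsilon>\<in>J. nat (int (Suc C) - \<epsilon> z a)) \<le> q"
        "\<forall>\<epsilon>\<in>E - J. int C < \<epsilon> z a \<and> \<not> twisted m k C e0 a d \<epsilon>" for q a d z
      using that
    proof (induction q arbitrary: a d)
      case 0
      then have "\<forall>\<epsilon>\<in>J. int C < \<epsilon> z a" using J(2) by auto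
      then show ?case using 0 by blast
    next
      case (Suc q)
      show ?case
      proof (cases "\<forall>\<epsilon>\<in>E. int C < \<epsilon> z a")
        case True
        then show ?thesis using Suc.prems by blast
      next
        case False
        then obtain \<delta> where \<delta>: "\<delta> \<in> E" "\<delta> z a \<le> int C" by force
        have \<delta>J: "\<delta> \<in> J"
        proof (rule ccontr)
          assume "\<delta> \<notin> J"
          then have "int C < \<delta> z a" using Suc.prems(8) \<delta>(1) by blast
          then show False using \<delta>(2) by simp
        qed
        have Nd: "N \<le> d" "e0 + q * N \<le> d - N" using Suc.prems(6) by auto
        \<comment> \<open>Only the top \<open>N\<close> levels below \<open>a\<close> matter. If
          \<open>\<delta>\<close> is not twisted there, fewer than \<open>n\<close> trees are, and
          the induction hypothesis applies with \<open>d - N\<close> as level bound.\<close>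
        show ?thesis
        proof (cases "twisted m k C (d - N) a d \<delta>")
          case False
          have "{\<epsilon> \<in> E. twisted m k C (d - N) a d \<epsilon>} \<subseteq> J - {\<delta>}"
          proof
            fix \<epsilon> assume "\<epsilon> \<in> {\<epsilon> \<in> E. twisted m k C (d - N) a d \<epsilon>}"
            then have \<epsilon>: "\<epsilon> \<in> E" "twisted m k C (d - N) a d \<epsilon>" by auto
            have "twisted m k C e0 a d \<epsilon>"
              by (rule twisted_mono[OF \<epsilon>(2)]) (use Nd in simp_all)
            then show "\<epsilon> \<in> J - {\<delta>}" using \<epsilon> False Suc.prems(8) by auto
          qed
          then have "card {\<epsilon> \<in> E. twisted m k C (d - N) a d \<epsilon>} \<le> card (J - {\<delta>})"
            using J(2) by (intro card_mono) auto
          also have "\<dots> < n" using J \<delta>J card_gt_0_iff[of J] by (auto simp: card_Diff_singleton)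
          finally show ?thesis using N[OF E Suc.prems(1,2), of "d - N"] Nd Suc.prems(3) by simp
        next
          case True
          then obtain e b where eb: "d - N \<le> e" "e < d" "m ^ Suc e dvd b" "b div m ^ d = a div m ^ d"
            "\<delta> (b + k * m ^ e) (b + Suc k * m ^ e) \<le> int C" by (auto simp: twisted_def)
          have b: "b < m ^ D" using less_power_if_div_eq eb(4) Suc.prems(2,3) by metis
          then obtain j where j: "j < m" "1 \<le> \<delta> b (b + j * m ^ e)"
            using block[OF \<delta>(1) _ b eb(3)] eb(2,5) Suc.prems(3) by force
          \<comment> \<open>\<open>b\<close> is the apex of a twisted block of
            \<open>\<delta>\<close>, and \<open>a'\<close> is a vertex of it with excess at least 1
            from \<open>b\<close>. Since \<open>z\<close> lies outside the regions of
            \<open>a\<close> and \<open>b\<close>, this unit adds to the excess from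
            \<open>z\<close>.\<close>
          define a' where "a' = b + j * m ^ e"
          have a'b: "a' div m ^ Suc e = b div m ^ Suc e" unfolding a'_def using div_add_digit eb(3) j(1) .
          then have a'a: "a' div m ^ d = a div m ^ d"
            using div_power_eq_mono[of a' m "Suc e" b d] eb by simp
          have a': "a' < m ^ D" using less_power_if_div_eq a'a Suc.prems(2,3) by metis
          have za: "\<epsilon> z a \<le> \<epsilon> z a'" if "\<epsilon> \<in> E" for \<epsilon>
            using super[OF that Suc.prems(1,2,4) a' a'a Suc.prems(5)] nonneg[OF that Suc.prems(2) a'] by simp
          have zb: "z div m ^ Suc e \<noteq> b div m ^ Suc e"
            using div_power_eq_mono[of z m "Suc e" b d] eb Suc.prems(5) by auto
          have "\<delta> z a \<le> \<delta> z b"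
            using super[OF \<delta>(1) Suc.prems(1,2,4) b eb(4) Suc.prems(5)] nonneg[OF \<delta>(1) Suc.prems(2) b] by simp
          then have gain: "\<delta> z a < \<delta> z a'"
            using super[OF \<delta>(1) eb(3) b Suc.prems(4) a' a'b zb] j(2) unfolding a'_def by linarith
          have "(\<Sum>\<epsilon>\<in>J. nat (int (Suc C) - \<epsilon> z a')) < (\<Sum>\<epsilon>\<in>J. nat (int (Suc C) - \<epsilon> z a))"
          proof (rule sum_strict_mono_ex1[OF J(2)])
            show "\<forall>\<epsilon>\<in>J. nat (int (Suc C) - \<epsilon> z a') \<le> nat (int (Suc C) - \<epsilon> z a)"
              using za J(1) by (auto intro!: nat_mono)
            show "\<exists>\<epsilon>\<in>J. nat (int (Suc C) - \<epsilon> z a') < nat (int (Suc C) - \<epsilon> z a)"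
              using gain \<delta>(2) \<delta>J by (intro bexI[of _ \<delta>]) auto
          qed
          then have sum: "(\<Sum>\<epsilon>\<in>J. nat (int (Suc C) - \<epsilon> z a')) \<le> q" using Suc.prems(7) by simp
          have "m ^ e dvd b" using eb(3) by (metis dvd_trans le_imp_power_dvd lessI less_imp_le)
          then have dvd: "m ^ e dvd a'" by (simp add: a'_def)
          have ze: "z div m ^ e \<noteq> a' div m ^ e"
            using div_power_eq_mono[of z m e a' d] eb a'a Suc.prems(5) by auto
          have tw: "\<not> twisted m k C e0 a' e \<epsilon>" if "\<not> twisted m k C e0 a d \<epsilon>" for \<epsilon>
            using that twisted_mono[OF _ _ _ a'a, of k C e0 e \<epsilon> e0] eb(2) by auto
          have "\<forall>\<epsilon>\<in>E - J. int C < \<epsilon> z a' \<and> \<not> twisted m k C e0 a' e \<epsilon>"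
          proof (intro ballI conjI)
            fix \<epsilon> assume "\<epsilon> \<in> E - J"
            then have *: "\<epsilon> \<in> E" "int C < \<epsilon> z a" "\<not> twisted m k C e0 a d \<epsilon>"
              using Suc.prems(8) by blast+
            show "int C < \<epsilon> z a'" using za[OF *(1)] *(2) by simp
            show "\<not> twisted m k C e0 a' e \<epsilon>" using tw[OF *(3)] .
          qed
          then show ?thesis
            using Suc.IH[OF dvd a' _ Suc.prems(4) ze _ sum] eb Nd Suc.prems(3) by simp
        qed
      qed
    qed
    obtain d where d: "d0 = Suc d" "e0 + n * Suc C * N \<le> d" using d0 by (cases d0) auto
    \<comment> \<open>The start is the last rung of the block of level \<open>d\<close> with apex
      \<open>a0\<close>: trees outside \<open>J\<close> are not twisted below \<open>a0\<close>, so
      their excess on it exceeds \<open>C\<close>.\<close>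
    define z x where "z = a0 + k * m ^ d" and "x = a0 + Suc k * m ^ d"
    have z: "z div m ^ d0 = a0 div m ^ d0" and x: "x div m ^ d0 = a0 div m ^ d0"
      unfolding z_def x_def d(1) using div_add_digit a0(1) m d(1) by (metis Suc_lessD)+
    have zx: "z < m ^ D" "x < m ^ D" using less_power_if_div_eq z x a0(2) d0(2) by metis+
    have dvd: "m ^ d dvd a0" using a0(1) d(1) by (metis dvd_trans le_imp_power_dvd lessI less_imp_le)
    have pos: "0 < m ^ d" using m by simp
    have ne: "z div m ^ d \<noteq> x div m ^ d"
      using dvd pos unfolding z_def x_def by (auto simp: dvd_def div_mult_self1)
    have nt: "int C < \<epsilon> z x" if "\<epsilon> \<in> E - J" for \<epsilon>
    proof (rule ccontr)
      assume "\<not> int C < \<epsilon> z x"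
      then have "twisted m k C e0 a0 d0 \<epsilon>" using d a0 unfolding twisted_def z_def x_def
        by (intro exI[of _ d] exI[of _ a0]) auto
      then show False using that by (auto simp: J_def)
    qed
    have nt': "\<not> twisted m k C e0 x d \<epsilon>" if "\<epsilon> \<in> E - J" for \<epsilon>
      using that twisted_mono[OF _ _ _ x, of k C e0 d \<epsilon> e0] d(1) unfolding J_def by auto
    \<comment> \<open>Initially each of the at most \<open>n\<close> trees of \<open>J\<close> lacks
      at most \<open>Suc C\<close>.\<close>
    have "(\<Sum>\<epsilon>\<in>J. nat (int (Suc C) - \<epsilon> z x)) \<le> card J * Suc C"
      using sum_bounded_above[of J "\<lambda>\<epsilon>. nat (int (Suc C) - \<epsilon> z x)" "Suc C"] nonneg[OF _ zx] J(1)
      by (auto simp: nat_le_iff subset_iff)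
    also have "\<dots> \<le> n * Suc C" using J(3) by (intro mult_right_mono) auto
    finally have sum: "(\<Sum>\<epsilon>\<in>J. nat (int (Suc C) - \<epsilon> z x)) \<le> n * Suc C" .
    show ?thesis
    proof (rule descend[OF _ zx(2) _ zx(1) ne _ sum])
      show "m ^ d dvd x" using dvd by (simp add: x_def)
      show "d \<le> D" using d d0 by simp
      show "e0 + n * Suc C * N \<le> d" by (rule d(2))
      show "\<forall>\<epsilon>\<in>E - J. int C < \<epsilon> z x \<and> \<not> twisted m k C e0 x d \<epsilon>" using nt nt' by blast
    qed
  qed
  then show ?case by (intro exI[of _ "Suc (n * Suc C * N)"]) blast
qed simp

lemma common_excess_pair:
  assumes "Suc k < m"
  obtains D where "\<And>E. finite E \<Longrightarrow> card E \<le> n \<Longrightarrow> \<forall>\<epsilon>\<in>E. excess_system m k C D \<epsilon> \<Longrightarrow>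
    \<exists>z<m ^ D. \<exists>x<m ^ D. \<forall>\<epsilon>\<in>E. int C < \<epsilon> z x"
proof -
  obtain N where N: "\<And>D E a d e0. \<lbrakk>finite E; \<forall>\<epsilon>\<in>E. excess_system m k C D \<epsilon>; m ^ d dvd a; a < m ^ D;
      e0 + N \<le> d; d \<le> D; card {\<epsilon> \<in> E. twisted m k C e0 a d \<epsilon>} < Suc n\<rbrakk> \<Longrightarrow>
      \<exists>z<m ^ D. \<exists>x<m ^ D. \<forall>\<epsilon>\<in>E. int C < \<epsilon> z x"
    by (rule exE[OF common_excess_pair_aux[OF assms, of C "Suc n"]]) (rule that, elim allE impE, assumption+)
  show ?thesis
  proof (rule that)
    fix E assume E: "finite E" "card E \<le> n" "\<forall>\<epsilon>\<in>E. excess_system m k C N \<epsilon>"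
    have "card {\<epsilon> \<in> E. twisted m k C 0 0 N \<epsilon>} \<le> card E" using E(1) by (intro card_mono) auto
    then show "\<exists>z<m ^ N. \<exists>x<m ^ N. \<forall>\<epsilon>\<in>E. int C < \<epsilon> z x"
      using N[OF E(1,3), of N 0 0] assms E(2) by simp
  qed
qed

section \<open>The tree of ladders\<close>

definition base :: "nat \<Rightarrow> nat" where
  "base k = Suc (2 * k)"

text \<open>
  A block is a ladder closed by a triangle at one end: its vertices are the signed digits
  \<open>- k, \<dots>, k\<close>, with apex \<open>0\<close>, the two sides \<open>1, \<dots>, k\<close> and \<open>- 1, \<dots>, - k\<close>, and the rungs
  \<open>{s, - s}\<close>. Negative digits are encoded by adding \<open>base k\<close>.
\<close>

definition signed_digit :: "nat \<Rightarrow> nat \<Rightarrow> int" where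
  "signed_digit k j = (if j \<le> k then int j else int j - int (base k))"

definition rung :: "nat \<Rightarrow> nat \<Rightarrow> nat \<Rightarrow> bool" where
  "rung k i j \<longleftrightarrow> i \<noteq> j \<and> signed_digit k i + signed_digit k j = 0"

definition ladder :: "nat \<Rightarrow> nat \<Rightarrow> nat \<Rightarrow> bool" where
  "ladder k i j \<longleftrightarrow> \<bar>signed_digit k i - signed_digit k j\<bar> = 1 \<or> rung k i j"

definition level_arc :: "nat \<Rightarrow> nat \<Rightarrow> nat \<Rightarrow> nat \<Rightarrow> bool" where
  "level_arc k d x y \<longleftrightarrow>
     base k ^ d dvd x \<and> base k ^ d dvd y \<and> x div base k ^ Suc d = y div base k ^ Suc d \<and>
     ladder k (x div base k ^ d mod base k) (y div base k ^ d mod base k)"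

text \<open>
  Blocks of level \<open>d\<close> vary the digit of weight \<open>base k ^ d\<close>. A vertex whose last \<open>d\<close> digits
  vanish is the apex of a block of each level below \<open>d\<close>.
\<close>

definition ladder_tree :: "nat \<Rightarrow> nat \<Rightarrow> nat pair_pre_digraph" where
  "ladder_tree k D =
     \<lparr> pverts = {..<base k ^ D},
       parcs = {(x, y). x < base k ^ D \<and> y < base k ^ D \<and> (\<exists>d<D. level_arc k d x y)} \<rparr>"

section \<open>Digit arithmetic and the arcs of a block\<close>

lemma base_pos [simp]: "0 < base k"
  by (simp add: base_def)

lemma base_neq_0 [simp]: "base k \<noteq> 0"
  by (simp add: base_def)

lemma ladder_sym: "ladder k i j \<Longrightarrow> ladder k j i"
  by (auto simp: ladder_def rung_def)

lemma ladder_irrefl: "\<not> ladder k i i"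
  by (simp add: ladder_def rung_def)

lemma level_arc_sym: "level_arc k d x y \<Longrightarrow> level_arc k d y x"
  by (auto simp: level_arc_def ladder_sym)

text \<open>Numerically consecutive digits run along one side away from the apex, cross the last
  rung from \<open>k\<close> to \<open>Suc k\<close>, the code of \<open>- k\<close>, and return
  along the other side.\<close>

lemma ladder_Suc: "Suc i < base k \<Longrightarrow> ladder k i (Suc i)"
  by (auto simp: ladder_def rung_def signed_digit_def base_def)

lemma signed_digit_inj:
  "i < base k \<Longrightarrow> j < base k \<Longrightarrow> signed_digit k i = signed_digit k j \<Longrightarrow> i = j"
  by (auto simp: signed_digit_def base_def split: if_splits)

lemma pverts_ladder_tree [simp]: "pverts (ladder_tree k D) = {..<base k ^ D}"
  by (simp add: ladder_tree_def)

lemma in_parcs_ladder_tree: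
  "(x, y) \<in> parcs (ladder_tree k D) \<longleftrightarrow>
     x < base k ^ D \<and> y < base k ^ D \<and> (\<exists>d<D. level_arc k d x y)"
  by (simp add: ladder_tree_def)

lemma pair_graph_ladder_tree: "pair_graph (ladder_tree k D)"
proof unfold_locales
  show "finite (parcs (ladder_tree k D))"
    by (rule finite_subset[of _ "{..<base k ^ D} \<times> {..<base k ^ D}"]) (auto simp: ladder_tree_def)
  show "symmetric (with_proj (ladder_tree k D))"
    by (auto simp: symmetric_def sym_def in_parcs_ladder_tree dest: level_arc_sym)
qed (auto simp: in_parcs_ladder_tree level_arc_def ladder_irrefl)

lemma digit_of_add:
  assumes "base k ^ Suc d dvd a" "j < base k"
  shows "(a + j * base k ^ d) div base k ^ d mod base k = j"
proof -
  obtain q where "a = base k ^ Suc d * q" using assms(1) by (auto simp: dvd_def)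
  then have "a + j * base k ^ d = (base k * q + j) * base k ^ d" by (simp add: algebra_simps)
  then show ?thesis using assms(2) by simp
qed

lemma power_dvd_if_Suc: "b ^ Suc d dvd a \<Longrightarrow> b ^ d dvd (a :: nat)"
  by (metis dvd_trans le_imp_power_dvd lessI less_imp_le)

lemma level_arc_digits:
  assumes "base k ^ Suc d dvd a" "i < base k" "j < base k" "ladder k i j"
  shows "level_arc k d (a + i * base k ^ d) (a + j * base k ^ d)"
  unfolding level_arc_def digit_of_add[OF assms(1,2)] digit_of_add[OF assms(1,3)]
    div_add_digit[OF assms(1,2)] div_add_digit[OF assms(1,3)]
  using assms power_dvd_if_Suc by (simp del: power_Suc)

lemma digit_vertex_less:
  assumes "base k ^ Suc d dvd a" "a < base k ^ D" "d < D" "j < base k"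
  shows "a + j * base k ^ d < base k ^ D"
  using less_power_if_div_eq[of _ _ "Suc d", OF div_add_digit] assms by auto

lemma ladder_tree_arc_digits:
  assumes "base k ^ Suc d dvd a" "a < base k ^ D" "d < D" "i < base k" "j < base k" "ladder k i j"
  shows "(a + i * base k ^ d, a + j * base k ^ d) \<in> parcs (ladder_tree k D)"
  using assms level_arc_digits digit_vertex_less by (auto simp: in_parcs_ladder_tree)

lemma vertex_eq_digit:
  assumes "base k ^ Suc d dvd a" "base k ^ d dvd x" "x div base k ^ Suc d = a div base k ^ Suc d"
  shows "x = a + (x div base k ^ d mod base k) * base k ^ d"
proof -
  have "x = base k ^ d * (x div base k ^ d)" using assms(2) by simp
  also have "x div base k ^ d = base k * (x div base k ^ Suc d) + x div base k ^ d mod base k"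
    by (metis div_mult2_eq mult_div_mod_eq power_Suc2)
  also have "base k ^ d * (base k * (x div base k ^ Suc d) + x div base k ^ d mod base k)
      = base k ^ Suc d * (a div base k ^ Suc d) + x div base k ^ d mod base k * base k ^ d"
    using assms(3) by (simp add: algebra_simps)
  also have "base k ^ Suc d * (a div base k ^ Suc d) = a" using assms(1) by (rule dvd_mult_div_cancel)
  finally show ?thesis by simp
qed

text \<open>Projection of the graph onto the block of level \<open>d\<close> with apex
  \<open>a\<close>: what hangs at a vertex of the block goes to the digit of that vertex, and
  everything beyond the apex goes to \<open>0\<close>.\<close>

definition block_digit :: "nat \<Rightarrow> nat \<Rightarrow> nat \<Rightarrow> nat \<Rightarrow> nat" where
  "block_digit k d a x =
     (if x div base k ^ Suc d = a div base k ^ Suc d then x div base k ^ d mod base k else 0)"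

lemma block_digit_vertex:
  assumes "base k ^ Suc d dvd a" "j < base k"
  shows "block_digit k d a (a + j * base k ^ d) = j"
  unfolding block_digit_def digit_of_add[OF assms] div_add_digit[OF assms] by simp

lemma block_digit_root:
  assumes "base k ^ Suc d dvd a"
  shows "block_digit k d a a = 0"
  using block_digit_vertex[OF assms, of 0] by simp

lemma level_arc_same_div:
  assumes "level_arc k e x y" "e < d"
  shows "x div base k ^ d = y div base k ^ d"
  using assms div_power_eq_mono[of x "base k" "Suc e" y d] by (auto simp: level_arc_def)

text \<open>Arcs of lower levels keep digit \<open>d\<close> and all higher ones; arcs of higher
  levels have digit \<open>0\<close> there at both ends. So the projection collapses all arcs but
  those of the block itself.\<close>

lemma level_arc_block_digit:
  assumes a: "base k ^ Suc d dvd a" and arc: "level_arc k e x y"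
    and neq: "block_digit k d a x \<noteq> block_digit k d a y"
  shows "ladder k (block_digit k d a x) (block_digit k d a y)"
    and "x = a + block_digit k d a x * base k ^ d"
    and "y = a + block_digit k d a y * base k ^ d"
proof -
  have *: "e = d"
  proof (rule linorder_cases[of e d])
    assume "e < d"
    then have "x div base k ^ d = y div base k ^ d" "x div base k ^ Suc d = y div base k ^ Suc d"
      using level_arc_same_div[OF arc] by (simp_all del: power_Suc)
    then have "block_digit k d a x = block_digit k d a y" unfolding block_digit_def by (simp only:)
    then show ?thesis using neq by contradiction
  next
    assume "d < e"
    have "z div base k ^ d mod base k = 0" if "base k ^ e dvd z" for z
    proof -
      have "base k ^ Suc d dvd z" using that \<open>d < e\<close> by (meson Suc_leI dvd_trans le_imp_power_dvd)
      then show ?thesis using digit_of_add[of k d z 0] by simp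
    qed
    then show ?thesis using arc neq by (auto simp: block_digit_def level_arc_def split: if_splits)
  qed
  have div: "x div base k ^ Suc d = a div base k ^ Suc d \<and> y div base k ^ Suc d = a div base k ^ Suc d"
    using arc neq unfolding * by (auto simp: block_digit_def level_arc_def split: if_splits)
  then show "ladder k (block_digit k d a x) (block_digit k d a y)"
    using arc unfolding * by (simp add: block_digit_def level_arc_def)
  show "x = a + block_digit k d a x * base k ^ d" "y = a + block_digit k d a y * base k ^ d"
    using vertex_eq_digit[OF a] arc div unfolding * by (simp_all add: block_digit_def level_arc_def)
qed

text \<open>An arc out of the region has level at least \<open>d\<close>, so its ends are multiples
  of \<open>base k ^ d\<close>, and \<open>a\<close> is the only such multiple in the region. This
  makes \<open>a\<close> a cut vertex.\<close>

lemma level_arc_leaves_region: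
  assumes a: "base k ^ d dvd a" and arc: "level_arc k e x y"
    and "x div base k ^ d = a div base k ^ d" "y div base k ^ d \<noteq> a div base k ^ d"
  shows "x = a"
proof -
  have "d \<le> e" using level_arc_same_div[OF arc, of d] assms(3,4) by force
  then have "base k ^ d dvd x" using arc by (meson dvd_trans le_imp_power_dvd level_arc_def)
  then show ?thesis using a assms(3) by (metis dvd_div_mult_self)
qed

section \<open>Connectedness of the tree of ladders\<close>

lemma ladder_tree_step_down:
  assumes "0 < x" "x < base k ^ D"
  shows "\<exists>y<x. (y, x) \<in> parcs (ladder_tree k D)"
proof -
  let ?b = "base k"
  have nd: "\<not> ?b ^ e dvd x" if "D \<le> e" for e
    using assms that by (metis dvd_imp_le le_imp_power_dvd dvd_trans not_le)
  \<comment> \<open>\<open>e\<close> is one more than the position \<open>d\<close> of the lowest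
    nonzero digit of \<open>x\<close>. Lowering that digit by one gives a neighbour, since
    consecutive digits are adjacent in a block.\<close>
  define e where "e = (LEAST e. \<not> ?b ^ e dvd x)"
  have e: "\<not> ?b ^ e dvd x" unfolding e_def using nd by (rule LeastI[of _ D]) simp
  then obtain d where d: "e = Suc d" by (cases e) auto
  then have dvd: "?b ^ d dvd x" using not_less_Least[of d "\<lambda>e. \<not> ?b ^ e dvd x"] by (auto simp: e_def)
  then have "d < D" using nd by (meson not_le)
  define a j where "a = x div ?b ^ Suc d * ?b ^ Suc d" and "j = x div ?b ^ d mod ?b"
  have a: "?b ^ Suc d dvd a" "x div ?b ^ Suc d = a div ?b ^ Suc d" by (simp_all add: a_def del: power_Suc)
  have x: "x = a + j * ?b ^ d" unfolding j_def by (rule vertex_eq_digit[OF a(1) dvd a(2)])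
  have "j \<noteq> 0"
  proof
    assume "j = 0"
    then have "x = a" using x by simp
    then show False using a(1) e d by simp
  qed
  then obtain i where i: "j = Suc i" by (cases j) auto
  have j: "j < ?b" by (simp add: j_def)
  have "(a + i * ?b ^ d, a + j * ?b ^ d) \<in> parcs (ladder_tree k D)"
    using a(1) x assms(2) \<open>d < D\<close> i j by (intro ladder_tree_arc_digits) (auto intro: ladder_Suc)
  then show ?thesis using x i by (intro exI[of _ "a + i * ?b ^ d"]) auto
qed

lemma connected_ladder_tree: "connected_graph (ladder_tree k D)"
proof -
  interpret pair_graph "ladder_tree k D" by (rule pair_graph_ladder_tree)
  let ?G = "with_proj (ladder_tree k D)"
  have root: "0 \<rightarrow>\<^sup>*\<^bsub>?G\<^esub> x" if "x < base k ^ D" for x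
    using that
  proof (induction x rule: less_induct)
    case (less x)
    show ?case
    proof (cases "x = 0")
      case True
      then show ?thesis using less.prems by (simp add: reachable_refl)
    next
      case False
      then obtain y where y: "y < x" "(y, x) \<in> parcs (ladder_tree k D)"
        using ladder_tree_step_down less.prems by blast
      then have "0 \<rightarrow>\<^sup>*\<^bsub>?G\<^esub> y" using less by simp
      then show ?thesis using reachable_adj_trans y(2) by simp
    qed
  qed
  have "strongly_connected ?G"
    unfolding strongly_connected_def
  proof (intro conjI ballI)
    show "verts ?G \<noteq> {}" using base_pos[of k] by (simp add: lessThan_empty_iff bot_nat_def)
    fix u v assume "u \<in> verts ?G" "v \<in> verts ?G"
    then have "0 \<rightarrow>\<^sup>*\<^bsub>?G\<^esub> u" "0 \<rightarrow>\<^sup>*\<^bsub>?G\<^esub> v" using root by auto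
    then show "u \<rightarrow>\<^sup>*\<^bsub>?G\<^esub> v" using symmetric_reachable[OF pair_sym_arcs] reachable_trans by blast
  qed
  \<comment> \<open>The library notion of connectedness is strong connectedness of the symmetric
    closure, which here is the graph itself.\<close>
  moreover have "parcs (mk_symmetric ?G) = parcs (ladder_tree k D)"
    using arcs_symmetric by (auto simp: mk_symmetric_def)
  then have "mk_symmetric ?G = ladder_tree k D"
    by (simp add: mk_symmetric_def ladder_tree_def)
  ultimately show ?thesis
    using pair_graph_ladder_tree by (simp add: connected_graph_def connected_def)
qed

section \<open>Stretch in the tree of ladders\<close>

lemma signed_digit_0 [simp]: "signed_digit k 0 = 0"
  by (simp add: signed_digit_def)

text \<open>Staying on one side of the ladder is optimal, because no arc changes the absolute signed
  digit of the projection by more than 1.\<close>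

lemma ladder_tree_dist_digit:
  assumes a: "base k ^ Suc d dvd a" "a < base k ^ D" "d < D" and j: "j < base k"
  shows "int (graph_dist (ladder_tree k D) a (a + j * base k ^ d)) = \<bar>signed_digit k j\<bar>"
proof (rule antisym)
  let ?G = "ladder_tree k D" and ?c = "\<lambda>j. a + j * base k ^ d"
  interpret pair_graph ?G by (rule pair_graph_ladder_tree)
  have c: "?c j \<in> pverts ?G" if "j < base k" for j using digit_vertex_less[OF a that] by simp
  have aV: "a \<in> pverts ?G" using a by simp
  have 0: "graph_dist ?G a a = 0" by (rule graph_dist_self[OF pair_wf_digraph aV])
  have step: "graph_dist ?G a (?c j) \<le> graph_dist ?G a (?c i) + 1"
    if "i < base k" "j < base k" "ladder k i j" for i j
    by (rule graph_dist_arc_right[OF connected_ladder_tree aV ladder_tree_arc_digits[OF a that]])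
  show "int (graph_dist ?G a (?c j)) \<le> \<bar>signed_digit k j\<bar>"
  proof (cases "j \<le> k")
    case True
    have "graph_dist ?G a (?c j) \<le> j"
      using True
    proof (induction j)
      case (Suc j)
      then show ?case using step[of j "Suc j"] ladder_Suc[of j k] by (auto simp: base_def)
    qed (simp add: 0)
    then show ?thesis using True by (simp add: signed_digit_def)
  next
    case False
    \<comment> \<open>The negative side is walked from its apex end, \<open>2 * k\<close> being the
      code of \<open>- 1\<close>, so the encoding decreases with \<open>t\<close>.\<close>
    have "t < k \<Longrightarrow> graph_dist ?G a (?c (2 * k - t)) \<le> Suc t" for t
    proof (induction t)
      case 0
      have "ladder k 0 (2 * k)" using 0 by (auto simp: ladder_def signed_digit_def base_def)
      then show ?case using step[of 0 "2 * k"] \<open>graph_dist ?G a a = 0\<close> by (simp add: base_def)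
    next
      case (Suc t)
      have "Suc (2 * k - Suc t) = 2 * k - t" using Suc.prems by simp
      then have "ladder k (2 * k - t) (2 * k - Suc t)"
        using ladder_Suc[of "2 * k - Suc t" k] Suc.prems by (auto simp: base_def intro: ladder_sym)
      moreover have "2 * k - t < base k" "2 * k - Suc t < base k" by (simp_all add: base_def)
      ultimately show ?case using step[of "2 * k - t" "2 * k - Suc t"] Suc by linarith
    qed
    moreover have "2 * k - j < k" "2 * k - (2 * k - j) = j" "int (Suc (2 * k - j)) = \<bar>signed_digit k j\<bar>"
      using False j by (auto simp: signed_digit_def base_def)
    ultimately show ?thesis by (metis of_nat_le_iff)
  qed
  define \<phi> where "\<phi> x = \<bar>signed_digit k (block_digit k d a x)\<bar>" for x
  have "\<phi> (?c j) - \<phi> a \<le> int (graph_dist ?G a (?c j))"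
  proof (rule graph_dist_lipschitz[OF connected_ladder_tree aV c[OF j]])
    fix x y assume "(x, y) \<in> parcs ?G"
    then obtain e where e: "level_arc k e x y" by (auto simp: in_parcs_ladder_tree)
    show "\<phi> y \<le> \<phi> x + 1"
      using level_arc_block_digit(1)[OF a(1) e]
      by (cases "block_digit k d a x = block_digit k d a y") (auto simp: \<phi>_def ladder_def rung_def)
  qed
  then show "\<bar>signed_digit k j\<bar> \<le> int (graph_dist ?G a (?c j))"
    using block_digit_vertex[OF a(1) j] block_digit_root[OF a(1)] by (simp add: \<phi>_def)
qed

definition excess :: "'a pair_pre_digraph \<Rightarrow> 'a pair_pre_digraph \<Rightarrow> 'a \<Rightarrow> 'a \<Rightarrow> int" where
  "excess G T u v = int (graph_dist T u v) - int (graph_dist G u v)"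

lemma excess_nonneg:
  assumes "undirected_spanning_tree T G" "connected_graph G" "u \<in> pverts G" "v \<in> pverts G"
  shows "0 \<le> excess G T u v"
  using assms graph_dist_subgraph[of T G u v]
  by (auto simp: undirected_spanning_tree_def undirected_tree_def spanning_def subgraph_def excess_def)

text \<open>The vertex \<open>a\<close> separates \<open>z\<close> from \<open>x\<close>, so
  distances in \<open>T\<close> through \<open>a\<close> add up, while in the graph the triangle
  inequality is enough.\<close>

lemma excess_ladder_tree_region:
  assumes T: "undirected_spanning_tree T (ladder_tree k D)"
    and a: "base k ^ d dvd a" "a < base k ^ D" and zx: "z < base k ^ D" "x < base k ^ D"
    and x: "x div base k ^ d = a div base k ^ d" and z: "z div base k ^ d \<noteq> a div base k ^ d"
  shows "excess (ladder_tree k D) T z a + excess (ladder_tree k D) T a x \<le> excess (ladder_tree k D) T z x"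
proof -
  let ?G = "ladder_tree k D"
  have conn: "connected_graph T" and V: "pverts T = {..<base k ^ D}" and sub: "parcs T \<subseteq> parcs ?G"
    using T by (auto simp: undirected_spanning_tree_def undirected_tree_def spanning_def subgraph_def)
  interpret T: pair_graph T using conn by (simp add: connected_graph_def)
  have aV: "a \<in> pverts T" "z \<in> pverts T" "x \<in> pverts T" using a zx V by auto
  have 0: "graph_dist T a a = 0" by (rule graph_dist_self[OF T.pair_wf_digraph aV(1)])
  define R where "R = {y. y div base k ^ d = a div base k ^ d}"
  \<comment> \<open>A signed distance to \<open>a\<close>, negative outside the region. Every arc
    between the two sides has its inner end at \<open>a\<close>, where the potential is 0.\<close>
  define \<phi> where "\<phi> y = (if y \<in> R then int (graph_dist T a y) else - int (graph_dist T y a))" for y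
  have "\<phi> x - \<phi> z \<le> int (graph_dist T z x)"
  proof (rule graph_dist_lipschitz[OF conn aV(2,3)])
    fix u v assume uv: "(u, v) \<in> parcs T"
    then have "(u, v) \<in> parcs ?G" using sub by blast
    then obtain e where e: "level_arc k e u v" by (auto simp: in_parcs_ladder_tree)
    note right = graph_dist_arc_right[OF conn aV(1) uv] and left = graph_dist_arc_left[OF conn aV(1) uv]
    have "u = a" if "u \<in> R" "v \<notin> R"
      using level_arc_leaves_region[OF a(1) e] that by (simp add: R_def)
    moreover have "v = a" if "v \<in> R" "u \<notin> R"
      using level_arc_leaves_region[OF a(1) level_arc_sym[OF e]] that by (simp add: R_def)
    ultimately show "\<phi> v \<le> \<phi> u + 1"
      using right left 0 by (auto simp: \<phi>_def)
  qed
  then have "int (graph_dist T z a) + int (graph_dist T a x) \<le> int (graph_dist T z x)"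
    using x z by (simp add: \<phi>_def R_def)
  moreover have "graph_dist ?G z x \<le> graph_dist ?G z a + graph_dist ?G a x"
    using a zx by (intro graph_dist_triangle connected_ladder_tree) auto
  ultimately show ?thesis by (simp add: excess_def)
qed

text \<open>
  A rung in \<open>T\<close> makes the distances to the root of its two ends differ, although they agree in
  the graph. Without rungs, the signed digit is a potential that separates the last rung.
\<close>

lemma excess_ladder_tree_block:
  assumes T: "undirected_spanning_tree T (ladder_tree k D)" and k: "0 < k"
    and a: "base k ^ Suc d dvd a" "a < base k ^ D" "d < D"
  shows "2 * int k - 1 \<le> excess (ladder_tree k D) T (a + k * base k ^ d) (a + Suc k * base k ^ d) \<or>
    (\<exists>j<base k. 1 \<le> excess (ladder_tree k D) T a (a + j * base k ^ d))"
proof -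
  let ?G = "ladder_tree k D" and ?c = "\<lambda>j. a + j * base k ^ d"
  have tree: "undirected_tree T" and conn: "connected_graph T" and V: "pverts T = {..<base k ^ D}"
    and sub: "parcs T \<subseteq> parcs ?G"
    using T by (auto simp: undirected_spanning_tree_def undirected_tree_def spanning_def subgraph_def)
  have c: "?c j < base k ^ D" if "j < base k" for j using digit_vertex_less[OF a that] .
  have kb: "k < base k" "Suc k < base k" using k by (auto simp: base_def)
  show ?thesis
  proof (cases "\<exists>i<base k. \<exists>j<base k. rung k i j \<and> (?c i, ?c j) \<in> parcs T")
    case True
    then obtain i j where ij: "i < base k" "j < base k" "rung k i j" "(?c i, ?c j) \<in> parcs T" by blast
    have "graph_dist T a (?c i) \<noteq> graph_dist T a (?c j)"
      using undirected_tree_dist_neq[OF tree ij(4)] a(2) V by simp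
    moreover have "int (graph_dist ?G a (?c i)) = int (graph_dist ?G a (?c j))"
      unfolding ladder_tree_dist_digit[OF a ij(1)] ladder_tree_dist_digit[OF a ij(2)]
      using ij(3) by (auto simp: rung_def)
    moreover have "0 \<le> excess ?G T a (?c i)" "0 \<le> excess ?G T a (?c j)"
      using excess_nonneg[OF T connected_ladder_tree] a(2) c ij by auto
    ultimately have "1 \<le> excess ?G T a (?c i) \<or> 1 \<le> excess ?G T a (?c j)"
      by (auto simp: excess_def)
    then show ?thesis using ij by blast
  next
    case False
    \<comment> \<open>The sign makes the potential rise from \<open>- k\<close> to \<open>k\<close>
      between the ends of the last rung, in the direction in which the distance is taken.\<close>
    define \<phi> where "\<phi> x = - signed_digit k (block_digit k d a x)" for x
    have "\<phi> (?c (Suc k)) - \<phi> (?c k) \<le> int (graph_dist T (?c k) (?c (Suc k)))"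
    proof (rule graph_dist_lipschitz[OF conn])
      fix x y assume xy: "(x, y) \<in> parcs T"
      then have "(x, y) \<in> parcs ?G" using sub by blast
      then obtain e where e: "level_arc k e x y" by (auto simp: in_parcs_ladder_tree)
      show "\<phi> y \<le> \<phi> x + 1"
      proof (cases "block_digit k d a x = block_digit k d a y")
        case neq: False
        note arc = level_arc_block_digit[OF a(1) e neq]
        have "block_digit k d a z < base k" for z by (auto simp: block_digit_def)
        then have "\<not> rung k (block_digit k d a x) (block_digit k d a y)"
          using False arc(2,3) xy by metis
        then show ?thesis using arc(1) by (auto simp: \<phi>_def ladder_def)
      qed (simp add: \<phi>_def)
    qed (use c[OF kb(1)] c[OF kb(2)] V in \<open>auto simp del: mult_Suc\<close>)
    moreover have "signed_digit k k = int k" "signed_digit k (Suc k) = - int k"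
      by (simp_all add: signed_digit_def base_def)
    ultimately have "2 * int k \<le> int (graph_dist T (?c k) (?c (Suc k)))"
      unfolding \<phi>_def block_digit_vertex[OF a(1) kb(1)] block_digit_vertex[OF a(1) kb(2)]
      by simp
    moreover have "pair_wf_digraph ?G"
      using pair_graph_ladder_tree by (intro pair_digraph.pair_wf_digraph pair_graph.axioms)
    then have "graph_dist ?G (?c k) (?c (Suc k)) \<le> 1"
      by (rule graph_dist_arc) (intro ladder_tree_arc_digits a kb ladder_Suc)
    ultimately show ?thesis by (simp add: excess_def)
  qed
qed

text \<open>Ladders of length \<open>Suc C\<close> are long enough, as
  \<open>2 * (C + 1) - 1\<close> exceeds \<open>C\<close>.\<close>

lemma excess_system_ladder_tree:
  assumes "undirected_spanning_tree T (ladder_tree (Suc C) D)"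
  shows "excess_system (base (Suc C)) (Suc C) C D (excess (ladder_tree (Suc C) D) T)"
  unfolding excess_system_def
proof (intro conjI allI impI)
  let ?b = "base (Suc C)"
  fix z x assume "z < ?b ^ D" "x < ?b ^ D"
  then show "0 \<le> excess (ladder_tree (Suc C) D) T z x"
    using excess_nonneg[OF assms connected_ladder_tree] by simp
next
  fix d a z x
  assume "base (Suc C) ^ d dvd a \<and> a < base (Suc C) ^ D \<and> z < base (Suc C) ^ D \<and> x < base (Suc C) ^ D \<and>
    x div base (Suc C) ^ d = a div base (Suc C) ^ d \<and> z div base (Suc C) ^ d \<noteq> a div base (Suc C) ^ d"
  then show "excess (ladder_tree (Suc C) D) T z a + excess (ladder_tree (Suc C) D) T a x
      \<le> excess (ladder_tree (Suc C) D) T z x"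
    using excess_ladder_tree_region[OF assms] by blast
next
  fix d a assume "d < D" "a < base (Suc C) ^ D" "base (Suc C) ^ Suc d dvd a"
  then show "int C < excess (ladder_tree (Suc C) D) T (a + Suc C * base (Suc C) ^ d)
        (a + Suc (Suc C) * base (Suc C) ^ d) \<or>
      (\<exists>j<base (Suc C). 1 \<le> excess (ladder_tree (Suc C) D) T a (a + j * base (Suc C) ^ d))"
    using excess_ladder_tree_block[OF assms, of d a] by (auto simp del: mult_Suc power_Suc)
qed

text \<open>The depth depends only on \<open>\<mu>\<close> and the integer bound \<open>C\<close>
  for \<open>c\<close>, so the graph is fixed before the trees are chosen.\<close>

lemma ladder_tree_not_spanned:
  fixes c :: real
  obtains k D where "\<And>\<T>. finite \<T> \<Longrightarrow> card \<T> \<le> \<mu> \<Longrightarrow> \<not> collectively_spans c \<T> (ladder_tree k D)"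
proof -
  define C where "C = nat \<lceil>c\<rceil>"
  have c: "c \<le> real C" unfolding C_def by linarith
  have "Suc (Suc C) < base (Suc C)" by (simp add: base_def)
  then obtain D where D: "\<And>E. finite E \<Longrightarrow> card E \<le> \<mu> \<Longrightarrow>
      \<forall>\<epsilon>\<in>E. excess_system (base (Suc C)) (Suc C) C D \<epsilon> \<Longrightarrow>
      \<exists>z<base (Suc C) ^ D. \<exists>x<base (Suc C) ^ D. \<forall>\<epsilon>\<in>E. int C < \<epsilon> z x"
    using common_excess_pair by metis
  let ?G = "ladder_tree (Suc C) D"
  show ?thesis
  proof (rule that, rule notI)
    fix \<T> assume \<T>: "finite \<T>" "card \<T> \<le> \<mu>" "collectively_spans c \<T> ?G"
    have "card (excess ?G ` \<T>) \<le> \<mu>" using card_image_le[OF \<T>(1)] \<T>(2) le_trans by blast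
    moreover have "\<forall>\<epsilon>\<in>excess ?G ` \<T>. excess_system (base (Suc C)) (Suc C) C D \<epsilon>"
      using \<T>(3) excess_system_ladder_tree by (auto simp: collectively_spans_def)
    ultimately obtain z x where zx: "z < base (Suc C) ^ D" "x < base (Suc C) ^ D"
      "\<forall>T\<in>\<T>. int C < excess ?G T z x"
      using D[of "excess ?G ` \<T>"] \<T>(1) by auto
    then obtain T where T: "T \<in> \<T>" "real (graph_dist T z x) \<le> real (graph_dist ?G z x) + c"
      using \<T>(3) unfolding collectively_spans_def pverts_ladder_tree by blast
    then have "real (graph_dist T z x) \<le> real (graph_dist ?G z x + C)" using c by simp
    then have "graph_dist T z x \<le> graph_dist ?G z x + C" by (simp only: of_nat_le_iff)
    then show False using zx(3) T(1) by (auto simp: excess_def)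
  qed
qed

section \<open>Holes and antiholes\<close>

lemma cycle_adjacent_iff:
  fixes i j n :: nat
  assumes "i < n" "j < n"
  shows "j = Suc i mod n \<or> i = Suc j mod n \<longleftrightarrow>
    j = (if i = 0 then n - 1 else i - 1) \<or> j = (if Suc i = n then 0 else Suc i)"
  using assms by (auto simp: mod_Suc)

text \<open>What holes and antiholes of length at least 5 have in common.\<close>

definition hole_like :: "('a \<Rightarrow> 'a \<Rightarrow> bool) \<Rightarrow> 'a set \<Rightarrow> bool" where
  "hole_like E S \<longleftrightarrow>
     (\<forall>v\<in>S. \<exists>u\<in>S. \<exists>w\<in>S. u \<noteq> w \<and> E v u \<and> E v w \<and> \<not> E u w) \<and>
     (\<forall>u\<in>S. \<forall>v\<in>S. \<forall>w\<in>S. \<forall>x\<in>S. u \<noteq> w \<and> v \<noteq> x \<and> E v u \<and> E v w \<and> E w x \<and> E u x \<longrightarrow>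
         (\<exists>y\<in>S. E v y \<and> y \<noteq> u \<and> y \<noteq> w))"

text \<open>\<open>p i\<close> and \<open>q i\<close> are the two neighbours of \<open>i\<close> on
  a cycle. The last assumption rules out closed tours of length 3 and 4, which makes the second
  condition of \<open>hole_like\<close> vacuous. The abstract form also covers the complement of a
  5-cycle.\<close>

lemma hole_like_rotation:
  fixes p q :: "nat \<Rightarrow> nat"
  assumes inj: "inj_on f I"
    and E: "\<And>i j. i \<in> I \<Longrightarrow> j \<in> I \<Longrightarrow> E (f i) (f j) \<longleftrightarrow> j = p i \<or> j = q i"
    and closed: "\<And>i. i \<in> I \<Longrightarrow> p i \<in> I \<and> q i \<in> I"
    and inverse: "\<And>i. i \<in> I \<Longrightarrow> p (q i) = i \<and> q (p i) = i"
    and neq: "\<And>i. i \<in> I \<Longrightarrow> p i \<noteq> i \<and> q i \<noteq> i \<and> p i \<noteq> q i \<and> p (p i) \<noteq> q i \<and> p (p i) \<noteq> q (q i)"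
  shows "hole_like E (f ` I)"
proof -
  have eq: "f i = f j \<longleftrightarrow> i = j" if "i \<in> I" "j \<in> I" for i j
    using inj that by (auto dest: inj_onD)
  have "\<exists>u\<in>I. \<exists>w\<in>I. f u \<noteq> f w \<and> E (f i) (f u) \<and> E (f i) (f w) \<and> \<not> E (f u) (f w)" if "i \<in> I" for i
  proof -
    have "q i \<noteq> p (p i)" "q i \<noteq> q (p i)" using neq[OF that] inverse[OF that] by metis+
    then show ?thesis
      using closed[OF that] neq[OF that] that E eq by (intro bexI[of _ "p i"] bexI[of _ "q i"]) auto
  qed
  moreover have False
    if "u \<in> I" "v \<in> I" "w \<in> I" "x \<in> I" "f u \<noteq> f w" "f v \<noteq> f x" "E (f v) (f u)" "E (f v) (f w)"
      "E (f w) (f x)" "E (f u) (f x)" for u v w x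
  proof -
    have ne: "u \<noteq> w" "v \<noteq> x" using that by auto
    have *: "u = p v \<or> u = q v" "w = p v \<or> w = q v" "x = p w \<or> x = q w" "x = p u \<or> x = q u"
      using E that by auto
    have inv: "p (q v) = v" "q (p v) = v" "p (p v) \<noteq> q (q v)" using inverse neq that(2) by auto
    show False using * ne inv by metis
  qed
  ultimately show ?thesis unfolding hole_like_def by auto blast
qed

lemma hole_like_hole:
  assumes "5 \<le> length vs" "induced_cycle G vs"
  shows "hole_like (\<lambda>x y. (x, y) \<in> parcs G) (set vs)"
proof -
  define n where "n = length vs"
  have n: "5 \<le> n" and dist: "distinct vs" using assms by (auto simp: n_def induced_cycle_def)
  have "hole_like (\<lambda>x y. (x, y) \<in> parcs G) ((!) vs ` {..<n})"
  proof (rule hole_like_rotation)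
    show "inj_on ((!) vs) {..<n}" using dist by (simp add: inj_on_nth n_def)
    show "(vs ! i, vs ! j) \<in> parcs G \<longleftrightarrow>
      j = (if i = 0 then n - 1 else i - 1) \<or> j = (if Suc i = n then 0 else Suc i)"
      if "i \<in> {..<n}" "j \<in> {..<n}" for i j
      using assms(2) that cycle_adjacent_iff[of i n j] by (auto simp: induced_cycle_def n_def)
  qed (use n in \<open>auto split: if_splits\<close>)
  moreover have "set vs = (!) vs ` {..<n}" by (auto simp: set_conv_nth n_def)
  ultimately show ?thesis by simp
qed

lemma hole_like_antihole:
  assumes "5 \<le> length vs" "induced_cycle (graph_complement G) vs" and loopless: "\<And>x. (x, x) \<notin> parcs G"
  shows "hole_like (\<lambda>x y. (x, y) \<in> parcs G) (set vs)"
proof -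
  define n where "n = length vs"
  have n: "5 \<le> n" and dist: "distinct vs" and sub: "set vs \<subseteq> pverts G"
    using assms by (auto simp: n_def induced_cycle_def graph_complement_def)
  have eq: "vs ! i = vs ! j \<longleftrightarrow> i = j" if "i < n" "j < n" for i j
    using dist that by (simp add: nth_eq_iff_index_eq n_def)
  have set: "set vs = (!) vs ` {..<n}" by (auto simp: set_conv_nth n_def)
  have adj: "(vs ! i, vs ! j) \<in> parcs G \<longleftrightarrow> i \<noteq> j \<and>
      j \<noteq> (if i = 0 then n - 1 else i - 1) \<and> j \<noteq> (if Suc i = n then 0 else Suc i)"
    if "i < n" "j < n" for i j
  proof (cases "i = j")
    case False
    have "(vs ! i, vs ! j) \<in> parcs (graph_complement G) \<longleftrightarrow> (vs ! i, vs ! j) \<notin> parcs G"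
      using that False eq sub set by (auto simp: graph_complement_def)
    then show ?thesis
      using assms(2) that False cycle_adjacent_iff[OF that] by (auto simp: induced_cycle_def n_def)
  qed (simp add: loopless)
  have "hole_like (\<lambda>x y. (x, y) \<in> parcs G) ((!) vs ` {..<n})"
  \<comment> \<open>The complement of a 5-cycle is again a 5-cycle, traversed in steps of 2.\<close>
  proof (cases "n = 5")
    case True
    show ?thesis
    proof (rule hole_like_rotation)
      show "inj_on ((!) vs) {..<n}" using dist by (simp add: inj_on_nth n_def)
      show "(vs ! i, vs ! j) \<in> parcs G \<longleftrightarrow> j = (if i < 2 then i + 3 else i - 2) \<or> j = (if i < 3 then i + 2 else i - 3)"
        if "i \<in> {..<n}" "j \<in> {..<n}" for i j
        using adj[of i j] that True by auto
    qed (use True in \<open>auto split: if_splits\<close>)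
  next
    case False
    \<comment> \<open>As \<open>n\<close> is at least 6, the cyclic offsets 2, 3 and 4 all lead to
      neighbours in \<open>G\<close>. Offsets 2 and 3 give two nonadjacent ones, and one of the
      three always avoids two given vertices.\<close>
    define r where "r t i = (if i + t < n then i + t else i + t - n)" for t i
    have r: "r t i < n" "(vs ! i, vs ! r t i) \<in> parcs G" if "i < n" "2 \<le> t" "t \<le> 4" for t i
    proof -
      show "r t i < n" using that n by (auto simp: r_def)
      then show "(vs ! i, vs ! r t i) \<in> parcs G"
        using adj[of i "r t i"] that n False by (auto simp: r_def split: if_splits)
    qed
    have ne: "r 2 i \<noteq> r 3 i" "r 2 i \<noteq> r 4 i" "r 3 i \<noteq> r 4 i" if "i < n" for i
      using n that by (auto simp: r_def split: if_splits)
    have "\<exists>u<n. \<exists>w<n. vs ! u \<noteq> vs ! w \<and> (vs ! i, vs ! u) \<in> parcs G \<and> (vs ! i, vs ! w) \<in> parcs G \<and>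
        (vs ! u, vs ! w) \<notin> parcs G" if i: "i < n" for i
    proof -
      have "(vs ! r 2 i, vs ! r 3 i) \<notin> parcs G"
      proof -
        have "r 3 i = (if Suc (r 2 i) = n then 0 else Suc (r 2 i))" using n i by (auto simp: r_def)
        moreover have "r 2 i < n" "r 3 i < n" using r(1)[OF i] by auto
        ultimately show ?thesis using adj[of "r 2 i" "r 3 i"] by metis
      qed
      then show ?thesis using r[OF i, of 2] r[OF i, of 3] ne[OF i] eq
        by (intro exI[of _ "r 2 i"] exI[of _ "r 3 i"] conjI) auto
    qed
    moreover have "\<exists>y<n. (vs ! v, vs ! y) \<in> parcs G \<and> vs ! y \<noteq> vs ! u \<and> vs ! y \<noteq> vs ! w"
      if "u < n" "v < n" "w < n" for u v w
    proof -
      have "\<exists>t\<in>{2, 3, 4}. r t v \<noteq> u \<and> r t v \<noteq> w" using ne[OF that(2)] by auto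
      then obtain t where "t \<in> {2, 3, 4}" "r t v \<noteq> u" "r t v \<noteq> w" by blast
      then show ?thesis using r[OF that(2), of t] eq that by (intro exI[of _ "r t v"]) auto
    qed
    ultimately show ?thesis unfolding hole_like_def by (simp add: Bex_def)
  qed
  then show ?thesis by (simp add: set)
qed

section \<open>Exclusion of hole-like sets in the tree of ladders\<close>

lemma level_arc_level_unique:
  assumes arc: "level_arc k e x y" and dvd: "base k ^ t dvd x" "base k ^ t dvd y" "\<not> base k ^ Suc t dvd x"
  shows "e = t"
proof (rule linorder_cases[of e t])
  assume "e < t"
  then have "base k ^ Suc e dvd x" "base k ^ Suc e dvd y"
    using dvd by (meson Suc_leI dvd_trans le_imp_power_dvd)+
  then have "x div base k ^ e mod base k = 0" "y div base k ^ e mod base k = 0"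
    using digit_of_add[of k e _ 0] by simp_all
  then show ?thesis using arc by (simp add: level_arc_def ladder_irrefl)
next
  assume "t < e"
  then have "base k ^ Suc t dvd x"
    using arc unfolding level_arc_def by (meson Suc_leI dvd_trans le_imp_power_dvd)
  then show ?thesis using dvd(3) by contradiction
qed

lemma digit_eq_0_iff:
  assumes "base k ^ t dvd x"
  shows "x div base k ^ t mod base k = 0 \<longleftrightarrow> base k ^ Suc t dvd x"
proof -
  obtain q where q: "x = base k ^ t * q" using assms by (auto simp: dvd_def)
  then show ?thesis by (auto simp: mod_eq_0_iff_dvd power_Suc2 simp del: power_Suc)
qed

lemma signed_digit_eq_0_iff: "j < base k \<Longrightarrow> signed_digit k j = 0 \<longleftrightarrow> j = 0"
  by (auto simp: signed_digit_def)

text \<open>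
  A vertex of \<open>S\<close> whose lowest nonzero digit is as low as possible and, among those, of largest
  absolute signed digit has only two neighbours left: its parent and its partner on the rung.
\<close>

lemma ladder_tree_not_hole_like:
  assumes S: "S \<subseteq> pverts (ladder_tree k D)" "S \<noteq> {}"
  shows "\<not> hole_like (\<lambda>x y. (x, y) \<in> parcs (ladder_tree k D)) S"
proof
  let ?G = "ladder_tree k D" and ?b = "base k"
  assume hole: "hole_like (\<lambda>x y. (x, y) \<in> parcs ?G) S"
  have fin: "finite S" using S(1) finite_subset by auto
  \<comment> \<open>Some vertex has two distinct neighbours in \<open>S\<close>, so \<open>S\<close>
    is not \<open>{0}\<close>; a nonzero vertex guarantees that a lowest nonzero digit
    exists.\<close>
  obtain v0 where v0: "v0 \<in> S" "v0 \<noteq> 0" using hole S(2) unfolding hole_like_def by (metis all_not_in_conv)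
  then have "v0 < ?b ^ D" using S(1) by auto
  then have nd: "\<not> ?b ^ D dvd v0" using v0(2) dvd_imp_le[of "?b ^ D" v0] by auto
  define P where "P e \<longleftrightarrow> (\<exists>v\<in>S. \<not> ?b ^ e dvd v)" for e
  \<comment> \<open>\<open>e\<close> is one more than the lowest position \<open>t\<close> at which
    a vertex of \<open>S\<close> has a nonzero digit.\<close>
  define e where "e = (LEAST e. P e)"
  have "P D" using v0 nd by (auto simp: P_def)
  then have Pe: "P e" unfolding e_def by (rule LeastI)
  then obtain t where t: "e = Suc t" by (cases e) (auto simp: P_def)
  then have dvd: "?b ^ t dvd v" if "v \<in> S" for v
    using not_less_Least[of t P] that by (auto simp: e_def P_def)
  define s where "s v = signed_digit k (v div ?b ^ t mod ?b)" for v
  have s0: "s v = 0 \<longleftrightarrow> ?b ^ Suc t dvd v" if "v \<in> S" for v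
    unfolding s_def using digit_eq_0_iff[OF dvd[OF that]] by (simp add: signed_digit_eq_0_iff)
  define M where "M = Max ((\<lambda>v. \<bar>s v\<bar>) ` S)"
  have M: "\<bar>s v\<bar> \<le> M" if "v \<in> S" for v using that fin by (simp add: M_def)
  have "M \<in> (\<lambda>v. \<bar>s v\<bar>) ` S" unfolding M_def using fin S(2) by (intro Max_in) auto
  then obtain v where v: "v \<in> S" "\<bar>s v\<bar> = M" by auto
  obtain v1 where "v1 \<in> S" "\<not> ?b ^ Suc t dvd v1" using Pe t by (auto simp: P_def)
  then have "0 < M" using s0[of v1] M[of v1] by force
  have arc: "x div ?b ^ Suc t = y div ?b ^ Suc t" "ladder k (x div ?b ^ t mod ?b) (y div ?b ^ t mod ?b)" "t < D"
    if "x \<in> S" "y \<in> S" "\<bar>s x\<bar> = M" "(x, y) \<in> parcs ?G" for x y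
  proof -
    from that(4) obtain f where f: "f < D" "level_arc k f x y" by (auto simp: in_parcs_ladder_tree)
    have "f = t"
      using level_arc_level_unique[OF f(2) dvd dvd] that s0[of x] \<open>0 < M\<close> by auto
    then show "x div ?b ^ Suc t = y div ?b ^ Suc t" "ladder k (x div ?b ^ t mod ?b) (y div ?b ^ t mod ?b)" "t < D"
      using f by (auto simp: level_arc_def)
  qed
  \<comment> \<open>A neighbour further out would exceed the maximum \<open>M\<close>; what remains
    is the partner on the rung and the next vertex towards the apex.\<close>
  have nbr: "s y = - s x \<or> s y = s x - sgn (s x)"
    if "x \<in> S" "y \<in> S" "\<bar>s x\<bar> = M" "(x, y) \<in> parcs ?G" for x y
  proof -
    have "\<bar>s x - s y\<bar> = 1 \<or> s x + s y = 0"
      using arc(2)[OF that] unfolding ladder_def rung_def s_def by auto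
    then show ?thesis using M[OF that(2)] that(3) by (auto simp: sgn_if split: if_splits)
  qed
  have same: "x = y"
    if "x \<in> S" "y \<in> S" "x div ?b ^ Suc t = y div ?b ^ Suc t" "s x = s y" for x y
  proof -
    let ?a = "x div ?b ^ Suc t * ?b ^ Suc t"
    have digit: "x div ?b ^ t mod ?b = y div ?b ^ t mod ?b"
      using that(4) unfolding s_def by (intro signed_digit_inj[of _ k]) auto
    have "z = ?a + z div ?b ^ t mod ?b * ?b ^ t" if "z \<in> S" "z div ?b ^ Suc t = x div ?b ^ Suc t" for z
      using vertex_eq_digit[OF _ dvd[OF that(1)], of ?a] that(2) by (simp del: power_Suc)
    then show ?thesis using that digit by metis
  qed
  \<comment> \<open>The two nonadjacent neighbours demanded by \<open>hole_like\<close> must be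
    exactly these two.\<close>
  have two: "\<exists>u\<in>S. \<exists>w\<in>S. (x, u) \<in> parcs ?G \<and> (x, w) \<in> parcs ?G \<and> (u, w) \<notin> parcs ?G \<and>
      s u = s x - sgn (s x) \<and> s w = - s x"
    if x: "x \<in> S" "\<bar>s x\<bar> = M" for x
  proof -
    obtain u w where uw: "u \<in> S" "w \<in> S" "u \<noteq> w" "(x, u) \<in> parcs ?G" "(x, w) \<in> parcs ?G" "(u, w) \<notin> parcs ?G"
      using hole x(1) unfolding hole_like_def by blast
    have "(w, u) \<notin> parcs ?G" using uw(6) level_arc_sym by (auto simp: in_parcs_ladder_tree)
    moreover have "s u \<noteq> s w"
      using same[OF uw(1,2)] uw arc(1)[OF x(1) uw(1) x(2) uw(4)] arc(1)[OF x(1) uw(2) x(2) uw(5)] by auto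
    ultimately show ?thesis
      using nbr[OF x(1) uw(1) x(2) uw(4)] nbr[OF x(1) uw(2) x(2) uw(5)] uw by metis
  qed
  obtain u w where uw: "u \<in> S" "w \<in> S" "(v, u) \<in> parcs ?G" "(v, w) \<in> parcs ?G" "(u, w) \<notin> parcs ?G"
    "s u = s v - sgn (s v)" "s w = - s v" using two[OF v] by blast
  have wM: "\<bar>s w\<bar> = M" using uw v by simp
  obtain x where x: "x \<in> S" "(w, x) \<in> parcs ?G" "s x = s w - sgn (s w)" using two[OF uw(2) wM] by blast
  note block = arc(1)[OF v(1) uw(1) v(2) uw(3)] arc(1)[OF v(1) uw(2) v(2) uw(4)] arc(1)[OF uw(2) x(1) wM x(2)]
  have level: "(y, z) \<in> parcs ?G"
    if "y \<in> S" "z \<in> S" "y div ?b ^ Suc t = z div ?b ^ Suc t" "ladder k (y div ?b ^ t mod ?b) (z div ?b ^ t mod ?b)" for y z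
    using that S(1) dvd arc(3)[OF v(1) uw(1) v(2) uw(3)] by (auto simp: in_parcs_ladder_tree level_arc_def)
  \<comment> \<open>For \<open>M = 1\<close> the inner neighbour is the apex, which is adjacent to
    the partner.\<close>
  have "M \<noteq> 1"
  proof
    assume "M = 1"
    then have "s u = 0" "\<bar>s w\<bar> = 1" using uw v by (auto simp: sgn_if split: if_splits)
    then have "ladder k (u div ?b ^ t mod ?b) (w div ?b ^ t mod ?b)" by (simp add: ladder_def s_def)
    then show False using level[OF uw(1,2)] block uw(5) by simp
  qed
  then have "2 \<le> M" using \<open>0 < M\<close> by simp
  \<comment> \<open>Now \<open>v\<close>, \<open>u\<close>, \<open>x\<close>, \<open>w\<close> form
    a 4-cycle with two consecutive rungs, so \<open>hole_like\<close> asks for a third neighbour of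
    \<open>v\<close>.\<close>
  then have sum: "s u + s x = 0" "s u \<noteq> s x" "s u \<noteq> s w" "s v \<noteq> s x"
    using uw x v by (auto simp: sgn_if split: if_splits)
  then have "rung k (u div ?b ^ t mod ?b) (x div ?b ^ t mod ?b)" unfolding rung_def s_def by metis
  then have ux: "(u, x) \<in> parcs ?G" using level[OF uw(1) x(1)] block by (simp add: ladder_def)
  have "\<exists>y\<in>S. (v, y) \<in> parcs ?G \<and> y \<noteq> u \<and> y \<noteq> w"
    using hole uw v x ux sum unfolding hole_like_def by metis
  then obtain y where y: "y \<in> S" "(v, y) \<in> parcs ?G" "y \<noteq> u" "y \<noteq> w" by blast
  have "s y = s w \<or> s y = s u" using nbr[OF v(1) y(1) v(2) y(2)] uw by simp
  then show False
    using same[OF y(1) uw(1)] same[OF y(1) uw(2)] y block arc(1)[OF v(1) y(1) v(2) y(2)] by auto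
qed

lemma weakly_chordal_ladder_tree: "weakly_chordal (ladder_tree k D)"
proof -
  interpret pair_graph "ladder_tree k D" by (rule pair_graph_ladder_tree)
  have loopless: "(x, x) \<notin> parcs (ladder_tree k D)" for x using no_loops' by blast
  have "set vs \<subseteq> pverts (ladder_tree k D)" "set vs \<noteq> {}"
    if "5 \<le> length vs" "induced_cycle (ladder_tree k D) vs \<or> induced_cycle (graph_complement (ladder_tree k D)) vs"
    for vs using that by (auto simp: induced_cycle_def graph_complement_def)
  then show ?thesis
    unfolding weakly_chordal_def
    using hole_like_hole hole_like_antihole[OF _ _ loopless] ladder_tree_not_hole_like by metis
qed

section \<open>Outerplanar drawing\<close>

definition parabola_point :: "nat \<Rightarrow> complex" where
  "parabola_point n = Complex (real n) ((real n)\<^sup>2)"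

lemma parabola_point_sel [simp]:
  "Re (parabola_point n) = real n" "Im (parabola_point n) = (real n)\<^sup>2"
  by (simp_all add: parabola_point_def)

lemma inj_parabola_point: "inj parabola_point"
  by (intro injI) (metis of_nat_eq_iff parabola_point_sel(1))

text \<open>The height of a chord above the parabola factorises and vanishes only at the two ends;
  chords are compared through this height.\<close>

lemma parabola_chord:
  assumes "z \<in> closed_segment (parabola_point x) (parabola_point y)" "x < y"
  shows "real x \<le> Re z" "Re z \<le> real y" "Im z - (Re z)\<^sup>2 = (Re z - real x) * (real y - Re z)"
proof -
  obtain t where t: "0 \<le> t" "t \<le> 1" and z: "z = (1 - t) *\<^sub>R parabola_point x + t *\<^sub>R parabola_point y"
    using assms(1) by (auto simp: closed_segment_def)
  have re: "Re z = real x + t * (real y - real x)" by (simp add: z algebra_simps)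
  have im: "Im z = (1 - t) * (real x)\<^sup>2 + t * (real y)\<^sup>2" by (simp add: z)
  have "0 \<le> t * (real y - real x)" "t * (real y - real x) \<le> 1 * (real y - real x)"
    using t assms(2) by (auto intro!: mult_right_mono)
  then show "real x \<le> Re z" "Re z \<le> real y" using re by auto
  show "Im z - (Re z)\<^sup>2 = (Re z - real x) * (real y - Re z)"
    unfolding re im by (simp add: algebra_simps power2_eq_square)
qed

text \<open>Over the inner of two nested intervals the outer chord is the higher one, except at a
  common end. The difference of the two heights is a sum of two nonnegative products.\<close>

lemma nested_products_eq:
  fixes a b c d s :: real
  assumes "a \<le> c" "c \<le> s" "s \<le> d" "d \<le> b" "(s - a) * (b - s) = (s - c) * (d - s)" "a \<noteq> c \<or> b \<noteq> d"
  shows "s = a \<and> s = c \<or> s = b \<and> s = d"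
proof -
  have "(c - a) * (b - s) + (s - c) * (b - d) = 0" using assms(5) by (simp add: algebra_simps)
  moreover have "0 \<le> (c - a) * (b - s)" "0 \<le> (s - c) * (b - d)"
    using assms by (auto intro!: mult_nonneg_nonneg)
  ultimately have "(c - a) * (b - s) = 0" "(s - c) * (b - d) = 0" by linarith+
  then show ?thesis using assms by auto
qed

lemma parabola_chords_meet:
  assumes xy: "x < y" and xy': "x' < y'" and ne: "{x, y} \<noteq> {x', y'}"
    and nc: "\<not> (x < x' \<and> x' < y \<and> y < y')" "\<not> (x' < x \<and> x < y' \<and> y' < y)"
    and z: "z \<in> closed_segment (parabola_point x) (parabola_point y)"
      "z \<in> closed_segment (parabola_point x') (parabola_point y')"
  shows "z \<in> parabola_point ` ({x, y} \<inter> {x', y'})"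
proof -
  note c = parabola_chord[OF z(1) xy] and c' = parabola_chord[OF z(2) xy']
  have eq: "(Re z - real x) * (real y - Re z) = (Re z - real x') * (real y' - Re z)"
    using c(3) c'(3) by simp
  have "\<exists>v\<in>{x, y} \<inter> {x', y'}. Re z = real v"
  proof -
    \<comment> \<open>Noncrossing intervals are disjoint up to a common end, or nested.\<close>
    consider "y \<le> x'" | "y' \<le> x" | "x \<le> x'" "y' \<le> y" | "x' \<le> x" "y \<le> y'" using nc by linarith
    then show ?thesis
    proof cases
      case 1
      then have "Re z = real y" "y = x'" using c(2) c'(1) by linarith+
      then show ?thesis by auto
    next
      case 2
      then have "Re z = real x" "x = y'" using c(1) c'(2) by linarith+
      then show ?thesis by auto
    next
      case 3
      have "real x \<noteq> real x' \<or> real y \<noteq> real y'" using ne by auto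
      then have "Re z = real x \<and> Re z = real x' \<or> Re z = real y \<and> Re z = real y'"
        using 3 c c' eq by (intro nested_products_eq) auto
      then show ?thesis by auto
    next
      case 4
      have "real x' \<noteq> real x \<or> real y' \<noteq> real y" using ne by auto
      then have "Re z = real x' \<and> Re z = real x \<or> Re z = real y' \<and> Re z = real y"
        using 4 c c' eq by (intro nested_products_eq) auto
      then show ?thesis by auto
    qed
  qed
  then obtain v where v: "v \<in> {x, y} \<inter> {x', y'}" "Re z = real v" by blast
  then have "Im z = (real v)\<^sup>2" using c(3) by auto
  then have "z = parabola_point v" using v(2) by (simp add: complex_eq_iff)
  then show ?thesis using v(1) by blast
qed

lemma below_parabola_outside:
  assumes "\<And>z. z \<in> K \<Longrightarrow> (Re z)\<^sup>2 \<le> Im z"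
  shows "{z. Im z < (Re z)\<^sup>2} \<subseteq> outside K"
proof
  let ?U = "{z. Im z < (Re z)\<^sup>2}"
  fix z assume z: "z \<in> ?U"
  \<comment> \<open>The region below the parabola is not convex; its connectedness is carried over
    from a half-plane by a continuous map.\<close>
  have "?U = (\<lambda>p. Complex (fst p) ((fst p)\<^sup>2 - snd p)) ` (UNIV \<times> {0<..})"
  proof (intro equalityI subsetI)
    fix w assume "w \<in> ?U"
    then show "w \<in> (\<lambda>p. Complex (fst p) ((fst p)\<^sup>2 - snd p)) ` (UNIV \<times> {0<..})"
      by (intro image_eqI[of _ _ "(Re w, (Re w)\<^sup>2 - Im w)"]) auto
  qed auto
  moreover have "topological_space_class.connected ((\<lambda>p. Complex (fst p) ((fst p)\<^sup>2 - snd p)) ` (UNIV \<times> {0<..} :: (real \<times> real) set))"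
    by (intro connected_continuous_image convex_connected convex_Times continuous_intros) auto
  ultimately have conn: "topological_space_class.connected ?U" by simp
  have sub: "?U \<subseteq> - K" using assms by force
  have "\<not> bounded ?U"
  proof
    assume "bounded ?U"
    then obtain B where B: "\<And>w. w \<in> ?U \<Longrightarrow> norm w \<le> B" by (auto simp: bounded_iff)
    have "norm (Complex 0 (- (\<bar>B\<bar> + 1))) \<le> B" by (rule B) auto
    moreover have "norm (Complex 0 (- (\<bar>B\<bar> + 1))) = \<bar>B\<bar> + 1" by (simp add: cmod_def)
    ultimately show False by simp
  qed
  moreover have "?U \<subseteq> connected_component_set (- K) z"
    using z conn sub by (rule connected_component_maximal)
  ultimately have "\<not> bounded (connected_component_set (- K) z)" using bounded_subset by blast
  then show "z \<in> outside K" using z sub by (auto simp: outside_def)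
qed

lemma parabola_point_closure_below: "parabola_point n \<in> closure {z. Im z < (Re z)\<^sup>2}"
proof (rule closure_approachable[THEN iffD2], intro allI impI)
  fix e :: real assume "0 < e"
  then show "\<exists>y\<in>{z. Im z < (Re z)\<^sup>2}. dist y (parabola_point n) < e"
    by (intro bexI[of _ "Complex (real n) ((real n)\<^sup>2 - e / 2)"])
      (auto simp: dist_norm parabola_point_def complex_diff cmod_def)
qed

text \<open>Chords stay on or above the parabola, so the region below it lies in the unbounded face
  and has every vertex in its closure.\<close>

lemma outerplanar_if_noncrossing:
  fixes G :: "nat pair_pre_digraph"
  assumes G: "pair_graph G"
    and noncrossing: "\<And>x y x' y'. (x, y) \<in> parcs G \<Longrightarrow> (x', y') \<in> parcs G \<Longrightarrow>
      x < x' \<Longrightarrow> x' < y \<Longrightarrow> y < y' \<Longrightarrow> False"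
  shows "outerplanar G"
proof -
  have wf: "x \<in> pverts G" "y \<in> pverts G" "x \<noteq> y" "(y, x) \<in> parcs G" if "(x, y) \<in> parcs G" for x y
  proof -
    interpret pair_graph G by fact
    show "x \<in> pverts G" "y \<in> pverts G" "x \<noteq> y" "(y, x) \<in> parcs G"
      using that in_arcsD1 in_arcsD2 no_loops' arcs_symmetric by blast+
  qed
  \<comment> \<open>An edge is a set, so its arc is oriented from the smaller to the larger
    vertex.\<close>
  define \<gamma> where "\<gamma> e = linepath (parabola_point (Min e)) (parabola_point (Max e))" for e :: "nat set"
  have edge: "\<exists>x y. e = {x, y} \<and> x < y \<and> (x, y) \<in> parcs G \<and> \<gamma> e = linepath (parabola_point x) (parabola_point y)"
    if "e \<in> graph_edges G" for e
  proof -
    from that obtain u v where uv: "e = {u, v}" "(u, v) \<in> parcs G" by (auto simp: graph_edges_def)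
    then obtain x y where xy: "e = {x, y}" "x < y" "(x, y) \<in> parcs G"
      using wf(3,4) by (metis insert_commute linorder_neqE_nat)
    then have "Min e = x" "Max e = y" by auto
    then show ?thesis using xy by (auto simp: \<gamma>_def)
  qed
  let ?K = "drawing_image G parabola_point \<gamma>"
  have K: "(Re z)\<^sup>2 \<le> Im z" if "z \<in> ?K" for z
  proof -
    from that consider v where "z = parabola_point v" | e where "e \<in> graph_edges G" "z \<in> path_image (\<gamma> e)"
      by (auto simp: drawing_image_def)
    then show ?thesis
    proof cases
      case 2
      then obtain x y where "x < y" "z \<in> closed_segment (parabola_point x) (parabola_point y)"
        using edge[OF 2(1)] by auto
      then have "0 \<le> Im z - (Re z)\<^sup>2" using parabola_chord[of z x y] by simp
      then show ?thesis by simp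
    qed simp
  qed
  have "plane_drawing G parabola_point \<gamma>"
    unfolding plane_drawing_def
  proof (intro conjI ballI impI)
    show "inj_on parabola_point (pverts G)" using inj_parabola_point inj_on_subset by blast
  next
    fix e assume e: "e \<in> graph_edges G"
    obtain x y where xy: "e = {x, y}" "x < y" "(x, y) \<in> parcs G" and
      \<gamma>e: "\<gamma> e = linepath (parabola_point x) (parabola_point y)" using edge[OF e] by blast
    have "parabola_point x \<noteq> parabola_point y" using xy(2) inj_parabola_point by (auto dest: injD)
    then show "arc (\<gamma> e)" unfolding \<gamma>e by (rule arc_linepath)
    show "{pathstart (\<gamma> e), pathfinish (\<gamma> e)} = parabola_point ` e" unfolding \<gamma>e by (simp add: xy(1))
    have "v = x \<or> v = y" if "parabola_point v \<in> closed_segment (parabola_point x) (parabola_point y)" for v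
      using parabola_chord(3)[OF that xy(2)] by auto
    then show "path_image (\<gamma> e) \<inter> parabola_point ` pverts G = parabola_point ` e"
      using wf(1,2)[OF xy(3)] unfolding \<gamma>e by (auto simp: xy(1))
  next
    fix e e' assume e: "e \<in> graph_edges G" "e' \<in> graph_edges G" "e \<noteq> e'"
    obtain x y where xy: "e = {x, y}" "x < y" "(x, y) \<in> parcs G" and
      \<gamma>e: "\<gamma> e = linepath (parabola_point x) (parabola_point y)" using edge[OF e(1)] by blast
    obtain x' y' where xy': "e' = {x', y'}" "x' < y'" "(x', y') \<in> parcs G" and
      \<gamma>e': "\<gamma> e' = linepath (parabola_point x') (parabola_point y')" using edge[OF e(2)] by blast
    show "path_image (\<gamma> e) \<inter> path_image (\<gamma> e') = parabola_point ` (e \<inter> e')"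
    proof (intro equalityI subsetI)
      fix z assume "z \<in> path_image (\<gamma> e) \<inter> path_image (\<gamma> e')"
      then show "z \<in> parabola_point ` (e \<inter> e')"
        using parabola_chords_meet[OF xy(2) xy'(2)] noncrossing[OF xy(3) xy'(3)] noncrossing[OF xy'(3) xy(3)] e(3)
        unfolding \<gamma>e \<gamma>e' unfolding xy(1) xy'(1) path_image_linepath by blast
    next
      fix z assume "z \<in> parabola_point ` (e \<inter> e')"
      then show "z \<in> path_image (\<gamma> e) \<inter> path_image (\<gamma> e')"
        unfolding \<gamma>e \<gamma>e' by (auto simp: xy(1) xy'(1))
    qed
  qed
  moreover have "parabola_point ` pverts G \<subseteq> frontier (outside ?K)"
  proof
    fix p assume p: "p \<in> parabola_point ` pverts G"
    have "closure {z. Im z < (Re z)\<^sup>2} \<subseteq> closure (outside ?K)"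
      using below_parabola_outside K by (intro closure_mono) blast
    then have "p \<in> closure (outside ?K)" using p parabola_point_closure_below by blast
    moreover have "p \<notin> outside ?K" using p by (auto simp: outside_def drawing_image_def)
    ultimately show "p \<in> frontier (outside ?K)" using interior_subset by (auto simp: frontier_def)
  qed
  ultimately show ?thesis unfolding outerplanar_def by blast
qed

section \<open>The arcs of the tree of ladders do not cross\<close>

lemma ladder_noncrossing:
  assumes "ladder k i j" "ladder k i' j'" "i < i'" "i' < j" "j < j'" "j' < base k"
  shows False
proof -
  \<comment> \<open>In the unsigned encoding the arcs are consecutive pairs, the pair
    \<open>{0, 2 * k}\<close> and the rungs, with digit sum \<open>base k\<close>. Rungs are nested,
    and the other two kinds cannot cross anything.\<close>
  have *: "m = Suc l \<or> l = 0 \<and> Suc m = base k \<or> l + m = base k" if "ladder k l m" "l < m" "m < base k" for l m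
    using that by (auto simp: ladder_def rung_def signed_digit_def base_def split: if_splits)
  show ?thesis using *[OF assms(1)] *[OF assms(2)] assms by auto
qed

lemma ladder_tree_noncrossing:
  assumes arcs: "(x, y) \<in> parcs (ladder_tree k D)" "(x', y') \<in> parcs (ladder_tree k D)"
    and order: "x < x'" "x' < y" "y < y'"
  shows False
proof -
  let ?b = "base k"
  obtain d where d: "level_arc k d x y" using arcs(1) by (auto simp: in_parcs_ladder_tree)
  obtain d' where d': "level_arc k d' x' y'" using arcs(2) by (auto simp: in_parcs_ladder_tree)
  \<comment> \<open>A multiple of \<open>m\<close> is the least number with its quotient, so it
    cannot lie strictly between two numbers of equal quotient. This settles arcs of different
    levels.\<close>
  have inside: False if "m dvd v" "u div m = w div m" "u < v" "v < w" for m u v w :: nat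
  proof -
    have "v div m \<le> u div m" using that(2,4) by (simp add: div_le_mono)
    then have "m * (v div m) \<le> m * (u div m)" by simp
    also have "\<dots> \<le> u" by simp
    finally show False using that(1,3) by simp
  qed
  show False
  proof (rule linorder_cases[of d d'])
    assume "d' < d"
    then show False using inside[of "?b ^ d" y x' y'] d order level_arc_same_div[OF d'] by (simp add: level_arc_def)
  next
    assume "d < d'"
    then show False using inside[of "?b ^ d'" x' x y] d' order level_arc_same_div[OF d] by (simp add: level_arc_def)
  next
    assume "d = d'"
    define a where "a = x div ?b ^ Suc d * ?b ^ Suc d"
    have a: "?b ^ Suc d dvd a" by (simp add: a_def)
    have xa: "x div ?b ^ Suc d = a div ?b ^ Suc d" by (simp add: a_def del: power_Suc)
    have yx: "y div ?b ^ Suc d = x div ?b ^ Suc d" using d by (simp add: level_arc_def)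
    have "x div ?b ^ Suc d \<le> x' div ?b ^ Suc d" "x' div ?b ^ Suc d \<le> y div ?b ^ Suc d"
      using order by (auto intro: div_le_mono less_imp_le simp del: power_Suc)
    then have x'x: "x' div ?b ^ Suc d = x div ?b ^ Suc d" using yx by simp
    have y'x: "y' div ?b ^ Suc d = x div ?b ^ Suc d"
      using d' x'x \<open>d = d'\<close> by (simp add: level_arc_def)
    define f where "f z = z div ?b ^ d mod ?b" for z
    have f: "z = a + f z * ?b ^ d" if "?b ^ d dvd z" "z div ?b ^ Suc d = x div ?b ^ Suc d" for z
      unfolding f_def using that xa by (intro vertex_eq_digit a) auto
    have dvd: "?b ^ d dvd x" "?b ^ d dvd y" "?b ^ d dvd x'" "?b ^ d dvd y'"
      using d d' \<open>d = d'\<close> by (auto simp: level_arc_def)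
    have eqs: "x = a + f x * ?b ^ d" "y = a + f y * ?b ^ d" "x' = a + f x' * ?b ^ d" "y' = a + f y' * ?b ^ d"
      using f dvd yx x'x y'x by blast+
    have less: "f u < f v" if "u = a + f u * ?b ^ d" "v = a + f v * ?b ^ d" "u < v" for u v
    proof -
      have "f u * ?b ^ d < f v * ?b ^ d" using that by linarith
      then show ?thesis by simp
    qed
    have "ladder k (f x) (f y)" "ladder k (f x') (f y')" using d d' \<open>d = d'\<close> by (auto simp: level_arc_def f_def)
    then show False
      using less[OF eqs(1,3) order(1)] less[OF eqs(3,2) order(2)] less[OF eqs(2,4) order(3)]
      by (rule ladder_noncrossing) (simp add: f_def)
  qed
qed

lemma outerplanar_ladder_tree: "outerplanar (ladder_tree k D)"
  using outerplanar_if_noncrossing[OF pair_graph_ladder_tree] ladder_tree_noncrossing by blast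

theorem theorem8:
  fixes c :: real and \<mu> :: nat
  assumes "c > 2" and "\<mu> > 0"
  shows "(\<exists>G :: nat pair_pre_digraph. connected_graph G \<and> weakly_chordal G \<and>
            \<not> (\<exists>\<T>. finite \<T> \<and> card \<T> \<le> \<mu> \<and> collectively_spans c \<T> G)) \<and>
         (\<exists>G :: nat pair_pre_digraph. connected_graph G \<and> outerplanar G \<and>
            \<not> (\<exists>\<T>. finite \<T> \<and> card \<T> \<le> \<mu> \<and> collectively_spans c \<T> G))"
proof -
  obtain k D where "\<And>\<T>. finite \<T> \<Longrightarrow> card \<T> \<le> \<mu> \<Longrightarrow> \<not> collectively_spans c \<T> (ladder_tree k D)"
    using ladder_tree_not_spanned by blast
  then show ?thesis
    using connected_ladder_tree weakly_chordal_ladder_tree outerplanar_ladder_tree by blast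
qed

end
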